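(* Let $X$ be a germ of holomorphic vector field at $0\in\mathbb{C}^n$ with $X(0)=0$, and let $F=\exp(X)\in\mathrm{Diff}(\mathbb{C}^n,0)$ be the time-$1$ map of $X$. Suppose that $F$ has the finite orbits property. Then $\mathrm{Spec}(D_0F)\subset e^{2\pi i\mathbb{Q}}$, i.e. every eigenvalue of $D_0F$ is a root of unity.
   Context: $\mathrm{Diff}(\mathbb{C}^n,0)$ is the group of germs at $0$ of biholomorphisms of $\mathbb{C}^n$ fixing $0$. For a representative $F:U\to V$ (a biholomorphism between open neighborhoods of $0$ with $F(0)=0$), $A\subset U\cap V$ and $p\in A$, put $O^+_{F,A}(p)=\{F^j(p): j\ge 0,\ F^k(p)\in A\text{ for all }0\le k\le j\}$ and $O_{F,A}(p)=O^+_{F,A}(p)\cup O^+_{F^{-1},A}(p)$. $F$ has the finite orbits property in $A$ if $O_{F,A}(p)$ is finite for all $p\in A$. A germ $F\in\mathrm{Diff}(\mathbb{C}^n,0)$ has the finite orbits property if there exist a representative $F:U\to V$ and a neighborhood $A\subset U\cap V$ of $0$ such that $F$ has the finite orbits property in $A$. *)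

theory Defs
  imports "HOL-Analysis.Analysis"
begin

text \<open>The library's \<open>holomorphic_on\<close> covers one complex variable only. In several variables,
  holomorphic on an open set means Frechet differentiable with complex-linear derivative.\<close>

definition holomorphic_map_on :: "(complex ^ 'n \<Rightarrow> complex ^ 'n) \<Rightarrow> (complex ^ 'n) set \<Rightarrow> bool"
  where "holomorphic_map_on f U \<longleftrightarrow>
    (\<forall>z\<in>U. \<exists>D. Vector_Spaces.linear (*s) (*s) D \<and> (f has_derivative D) (at z))"

definition biholomorphism ::
    "(complex ^ 'n) set \<Rightarrow> (complex ^ 'n) set \<Rightarrow> (complex ^ 'n \<Rightarrow> complex ^ 'n) \<Rightarrow> bool"
  where "biholomorphism U V F \<longleftrightarrow> open U \<and> open V \<and> bij_betw F U V \<and>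
    holomorphic_map_on F U \<and> holomorphic_map_on (inv_into U F) V"

text \<open>Germs at \<open>0\<close> are given by total functions that matter only near \<open>0\<close>; two of them define
  the same germ iff they agree eventually in \<open>nhds 0\<close>.\<close>

definition diff_representative ::
    "(complex ^ 'n) set \<Rightarrow> (complex ^ 'n) set \<Rightarrow> (complex ^ 'n \<Rightarrow> complex ^ 'n) \<Rightarrow>
     (complex ^ 'n \<Rightarrow> complex ^ 'n) \<Rightarrow> bool"
  where "diff_representative U V G F \<longleftrightarrow> 0 \<in> U \<and> 0 \<in> V \<and> biholomorphism U V G \<and> G 0 = 0 \<and>
    (\<forall>\<^sub>F z in nhds 0. G z = F z)"

text \<open>In the two definitions of orbits below, \<open>A\<close> is contained in the domain of the map that is
  iterated. All points before the last lie in \<open>A\<close>, so values outside the domain play no role.\<close>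

definition positive_orbit :: "('a \<Rightarrow> 'a) \<Rightarrow> 'a set \<Rightarrow> 'a \<Rightarrow> 'a set"
  where "positive_orbit F A p = {(F ^^ j) p | j. \<forall>k\<le>j. (F ^^ k) p \<in> A}"

definition orbit_in :: "'a set \<Rightarrow> ('a \<Rightarrow> 'a) \<Rightarrow> 'a set \<Rightarrow> 'a \<Rightarrow> 'a set"
  where "orbit_in U F A p = positive_orbit F A p \<union> positive_orbit (inv_into U F) A p"

definition finite_orbits_in :: "'a set \<Rightarrow> ('a \<Rightarrow> 'a) \<Rightarrow> 'a set \<Rightarrow> bool"
  where "finite_orbits_in U F A \<longleftrightarrow> (\<forall>p\<in>A. finite (orbit_in U F A p))"

definition finite_orbits_property :: "(complex ^ 'n \<Rightarrow> complex ^ 'n) \<Rightarrow> bool"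
  where "finite_orbits_property F \<longleftrightarrow>
    (\<exists>U V G A. diff_representative U V G F \<and> A \<subseteq> U \<inter> V \<and> 0 \<in> interior A \<and>
      finite_orbits_in U G A)"

text \<open>\<open>F\<close> is a representative of the germ \<open>exp(X)\<close>, where \<open>X\<close> is a vector field on \<open>W\<close>: for every
  \<open>p\<close> close to \<open>0\<close> the integral curve of \<open>X\<close> starting at \<open>p\<close> exists in \<open>W\<close> up to time \<open>1\<close>, where
  it reaches \<open>F p\<close>. For \<open>X\<close> holomorphic the curve is unique, and if \<open>X 0 = 0\<close> the germ of \<open>F\<close>
  does not depend on the choice of \<open>W\<close>.\<close>

definition integral_curve ::
    "(complex ^ 'n) set \<Rightarrow> (complex ^ 'n \<Rightarrow> complex ^ 'n) \<Rightarrow> (real \<Rightarrow> complex ^ 'n) \<Rightarrow> real set \<Rightarrow> bool"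
  where "integral_curve W X \<gamma> T \<longleftrightarrow>
    (\<forall>t\<in>T. \<gamma> t \<in> W \<and> (\<gamma> has_vector_derivative X (\<gamma> t)) (at t within T))"

definition time_one_map_germ ::
    "(complex ^ 'n) set \<Rightarrow> (complex ^ 'n \<Rightarrow> complex ^ 'n) \<Rightarrow> (complex ^ 'n \<Rightarrow> complex ^ 'n) \<Rightarrow> bool"
  where "time_one_map_germ W X F \<longleftrightarrow>
    (\<forall>\<^sub>F p in nhds 0. \<exists>\<gamma>. integral_curve W X \<gamma> {0..1} \<and> \<gamma> 0 = p \<and> \<gamma> 1 = F p)"

definition Spec :: "(complex ^ 'n \<Rightarrow> complex ^ 'n) \<Rightarrow> complex set"
  where "Spec D = {c. \<exists>v. v \<noteq> 0 \<and> D v = c *s v}"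

end

theory Submission
  imports
    Defs
    "HOL-Complex_Analysis.Conformal_Mappings"
    "HOL-Computational_Algebra.Fundamental_Theorem_Algebra"
begin

text \<open>
  Let \<open>D\<close> be the linear part of \<open>X\<close> at \<open>0\<close>. The derivative of the time one map is \<open>exp D\<close>, so
  every eigenvalue of it is \<open>exp \<mu>\<close> for an eigenvalue \<open>\<mu>\<close> of \<open>D\<close>. Suppose that \<open>exp \<mu>\<close> is not a
  root of unity, and let \<open>\<nu>\<close> be the largest multiple \<open>m \<mu>\<close>, \<open>m \<ge> 1\<close>, that is an eigenvalue of
  \<open>D\<close>, with eigenvector \<open>v\<close>. Since \<open>k \<nu>\<close> is not an eigenvalue for \<open>k \<ge> 2\<close>, the Briot-Bouquet
  equation \<open>\<nu> z f'(z) = X(f(z))\<close>, \<open>f(0) = 0\<close>, \<open>f'(0) = v\<close> has a holomorphic solution near \<open>0\<close>.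
  Its image is an invariant curve on which the time one map acts as \<open>f(z) \<mapsto> f(e\<^sup>\<nu> z)\<close>. As \<open>e\<^sup>\<nu>\<close> is
  not a root of unity, the points of the curve have infinite orbits near \<open>0\<close>, forwards if
  \<open>\<bar>e\<^sup>\<nu>\<bar> \<le> 1\<close> and backwards otherwise.
\<close>

unbundle no fps_syntax

section \<open>Holomorphic maps from the plane to complex coordinate space\<close>

text \<open>Linearising \<open>X\<close> as a whole would run into resonances between different
  eigenvalues and into small divisors. A single invariant curve avoids both. The coefficient of
  order k of the unknown curve is found by inverting \<open>k \<nu> - D\<close>, so the only
  obstructions are the eigenvalues \<open>k \<nu>\<close> with k at least 2, and passing to the
  largest multiple of \<open>\<mu>\<close> removes them. The price is harmless:
  \<open>exp \<nu>\<close> is a power of \<open>exp \<mu>\<close>, with positive exponent, so it is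
  not a root of unity either. The time one map is known only through the existence of integral
  curves, and \<open>X\<close> is controlled only near 0. One Gronwall estimate, valid as long as
  the difference of two curves stays small, therefore serves twice: it identifies the derivative of
  the time one map with the exponential of \<open>D\<close>, and it gives the uniqueness that fixes
  the action on the curve. The spectra are compared without a normal form: \<open>D\<close> commutes
  with its exponential, so it preserves the eigenspaces of the latter and has eigenvectors in
  them.\<close>

lemma norm_smult_vec: "norm (c *s v) = norm c * norm v"
  for c :: complex and v :: "complex ^ 'n"
  by (simp add: norm_vec_def norm_mult L2_set_right_distrib)

lemma scaleR_eq_smult: "r *\<^sub>R v = complex_of_real r *s v" for v :: "complex ^ 'n"
  by (simp add: vec_eq_iff scaleR_conv_of_real[symmetric])
  
lemma bounded_linear_smult_left: "bounded_linear (\<lambda>h. h *s v)" for v :: "complex ^ 'n"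
  by (rule bounded_linear_intro[where K = "norm v"])
     (auto simp: vec_eq_iff algebra_simps norm_smult_vec)

lemma bounded_linear_smult_right: "bounded_linear ((*s) c :: complex ^ 'n \<Rightarrow> complex ^ 'n)"
  by (rule bounded_linear_intro[where K = "norm c"])
     (auto simp: vec_eq_iff algebra_simps norm_smult_vec)

lemma norm_le_sum_components: "norm v \<le> (\<Sum>i\<in>UNIV. norm (v $ i))" for v :: "complex ^ 'n"
  unfolding norm_vec_def by (intro L2_set_le_sum) auto

text \<open>The form of the derivative forces complex linearity in \<open>h\<close>, so this is
  complex differentiability of a curve, with \<open>v\<close> as its velocity.\<close>

definition has_vec_deriv ::
    "(complex \<Rightarrow> complex ^ 'n) \<Rightarrow> complex ^ 'n \<Rightarrow> complex \<Rightarrow> bool"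
  where "has_vec_deriv f v z \<longleftrightarrow> (f has_derivative (\<lambda>h. h *s v)) (at z)"

definition vec_holomorphic_on :: "(complex \<Rightarrow> complex ^ 'n) \<Rightarrow> complex set \<Rightarrow> bool"
  where "vec_holomorphic_on f S \<longleftrightarrow> (\<forall>z\<in>S. \<exists>v. has_vec_deriv f v z)"

lemma has_vec_deriv_component_iff:
  fixes f :: "complex \<Rightarrow> complex ^ 'n"
  shows "has_vec_deriv f v z \<longleftrightarrow> (\<forall>i. ((\<lambda>z. f z $ i) has_field_derivative v $ i) (at z))"
proof
  assume "has_vec_deriv f v z"
  then have "((\<lambda>z. f z $ i) has_derivative (\<lambda>h. (h *s v) $ i)) (at z)" for i
    unfolding has_vec_deriv_def by (rule bounded_linear.has_derivative[OF bounded_linear_vec_nth])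
  moreover have "(\<lambda>h. (h *s v) $ i) = (*) (v $ i)" for i
    by (auto simp: mult.commute)
  ultimately show "\<forall>i. ((\<lambda>z. f z $ i) has_field_derivative v $ i) (at z)"
    by (simp add: has_field_derivative_def)
next
  assume *: "\<forall>i. ((\<lambda>z. f z $ i) has_field_derivative v $ i) (at z)"
  show "has_vec_deriv f v z"
    unfolding has_vec_deriv_def
  proof (subst has_derivative_componentwise_within, intro ballI)
    fix j :: "complex ^ 'n" assume "j \<in> Basis"
    then obtain i b where j: "j = axis i b" by (auto simp: Basis_vec_def)
    have "((\<lambda>z. f z $ i \<bullet> b) has_derivative (\<lambda>h. (v $ i * h) \<bullet> b)) (at z)"
      using * by (intro has_derivative_inner_left) (simp add: has_field_derivative_def)
    then show "((\<lambda>x. f x \<bullet> j) has_derivative (\<lambda>x. (x *s v) \<bullet> j)) (at z)"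
      by (simp add: j inner_axis mult.commute)
  qed
qed

lemma vec_holomorphic_on_component_iff:
  assumes "open S"
  shows "vec_holomorphic_on f S \<longleftrightarrow> (\<forall>i. (\<lambda>z. f z $ i) holomorphic_on S)"
proof
  assume "vec_holomorphic_on f S"
  then show "\<forall>i. (\<lambda>z. f z $ i) holomorphic_on S"
    unfolding vec_holomorphic_on_def has_vec_deriv_component_iff
    by (auto simp: holomorphic_on_open[OF assms])
next
  assume *: "\<forall>i. (\<lambda>z. f z $ i) holomorphic_on S"
  show "vec_holomorphic_on f S"
    unfolding vec_holomorphic_on_def has_vec_deriv_component_iff
  proof
    fix z assume "z \<in> S"
    then show "\<exists>v. \<forall>i. ((\<lambda>z. f z $ i) has_field_derivative v $ i) (at z)"
      using * assms by (intro exI[of _ "\<chi> i. deriv (\<lambda>z. f z $ i) z"])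
        (auto intro: holomorphic_derivI)
  qed
qed

lemma holomorphic_map_on_comp_vec:
  assumes "holomorphic_map_on X W" "vec_holomorphic_on f S" "f ` S \<subseteq> W"
  shows "vec_holomorphic_on (\<lambda>z. X (f z)) S"
  unfolding vec_holomorphic_on_def
proof
  fix z assume z: "z \<in> S"
  then obtain v where v: "(f has_derivative (\<lambda>h. h *s v)) (at z)"
    using assms(2) by (auto simp: vec_holomorphic_on_def has_vec_deriv_def)
  obtain D where D: "Vector_Spaces.linear (*s) (*s) D" "(X has_derivative D) (at (f z))"
    using assms z by (force simp: holomorphic_map_on_def)
  interpret Vector_Spaces.linear "(*s)" "(*s)" D by fact
  have "((\<lambda>z. X (f z)) has_derivative (\<lambda>h. D (h *s v))) (at z)"
    using has_derivative_compose[OF v D(2)] .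
  then have "has_vec_deriv (\<lambda>z. X (f z)) (D v) z"
    by (simp add: has_vec_deriv_def scale)
  then show "\<exists>v. has_vec_deriv (\<lambda>z. X (f z)) v z" ..
qed

section \<open>A Gronwall inequality\<close>

text \<open>The growth bound is required only while \<open>norm (d t)\<close> is at most
  \<open>\<delta>\<close>, because \<open>X\<close> is controlled only near 0. The barrier
  \<open>b * exp ((c + 1) * t)\<close> stays below \<open>\<delta>\<close> on the unit interval, so
  up to the first crossing the bound is available. The extra 1 in the exponent absorbs the term
  \<open>b\<close>, as the barrier is at least \<open>b\<close>.\<close>

lemma norm_lt_exponential_of_deriv_bound:
  fixes d :: "real \<Rightarrow> 'a::real_normed_vector"
  assumes deriv: "\<And>t. t \<in> {0..1} \<Longrightarrow> (d has_vector_derivative d' t) (at t within {0..1})"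
    and "d 0 = 0" "0 < b" "0 \<le> c" "b * exp (c + 1) \<le> \<delta>"
    and bound: "\<And>t. t \<in> {0..1} \<Longrightarrow> norm (d t) \<le> \<delta> \<Longrightarrow> norm (d' t) \<le> c * norm (d t) + b"
    and t: "t \<in> {0..1}"
  shows "norm (d t) < b * exp ((c + 1) * t)"
proof (rule ccontr)
  define \<phi> where "\<phi> = (\<lambda>t. b * exp ((c + 1) * t))"
  have contd: "continuous_on {0..1} d"
    using deriv has_vector_derivative_continuous
    by (fastforce simp: continuous_on_eq_continuous_within)
  have cont\<phi>: "continuous_on T \<phi>" for T
    unfolding \<phi>_def by (intro continuous_intros)
  assume "\<not> norm (d t) < b * exp ((c + 1) * t)"
  define S where "S = {t\<in>{0..1}. \<phi> t \<le> norm (d t)}"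
  have "closed S" unfolding S_def
    by (intro continuous_on_closed_Collect_le cont\<phi> continuous_on_norm contd) auto
  have "t \<in> S" using t \<open>\<not> _\<close> by (auto simp: S_def \<phi>_def)
  define T where "T = Inf S"
  have "bdd_below S" by (auto simp: S_def intro: bdd_belowI[of _ 0])
  have "T \<in> S" unfolding T_def
    using \<open>closed S\<close> \<open>t \<in> S\<close> \<open>bdd_below S\<close> by (intro closed_contains_Inf) auto
  have below: "norm (d s) < \<phi> s" if "0 \<le> s" "s < T" for s
    using that \<open>T \<in> S\<close> cInf_lower[OF _ \<open>bdd_below S\<close>, of s]
    by (force simp: S_def T_def)
  have "T \<noteq> 0" using \<open>T \<in> S\<close> assms by (auto simp: S_def \<phi>_def)
  with \<open>T \<in> S\<close> have T: "0 < T" "T \<le> 1" by (auto simp: S_def)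
  \<comment> \<open>Up to the first crossing time \<open>T\<close> the barrier grows at least as
    fast as \<open>d\<close>, and it starts ahead by \<open>b > 0\<close>; so it is still strictly
    ahead at \<open>T\<close>.\<close>
  have "norm (d T - d 0) \<le> \<phi> T - \<phi> 0"
  proof (rule differentiable_bound_general[where f' = d' and \<phi>' = "\<lambda>t. (c + 1) * \<phi> t"])
    show "continuous_on {0..T} d" using contd T by (auto intro: continuous_on_subset)
    fix s assume s: "0 < s" "s < T"
    show "(d has_vector_derivative d' s) (at s)"
      using deriv[of s] s T by (simp add: at_within_Icc_at)
    show "(\<phi> has_vector_derivative (c + 1) * \<phi> s) (at s)"
      unfolding \<phi>_def has_real_derivative_iff_has_vector_derivative[symmetric]
      by (auto intro!: derivative_eq_intros)
    have "(c + 1) * s \<le> c + 1" using s T \<open>0 \<le> c\<close> by (intro mult_left_le) auto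
    then have "\<phi> s \<le> b * exp (c + 1)" using \<open>0 < b\<close> by (auto simp: \<phi>_def)
    then have "norm (d s) \<le> \<delta>" using below[of s] s assms by linarith
    then have "norm (d' s) \<le> c * norm (d s) + b" using bound[of s] s T by auto
    also have "\<dots> \<le> c * \<phi> s + b" using below[of s] s \<open>0 \<le> c\<close> by (auto intro: mult_left_mono)
    also have "b \<le> \<phi> s" using s \<open>0 < b\<close> \<open>0 \<le> c\<close> by (auto simp: \<phi>_def)
    finally show "norm (d' s) \<le> (c + 1) * \<phi> s" by (simp add: algebra_simps)
  qed (use T cont\<phi> in auto)
  then have "norm (d T) < \<phi> T" using assms by (simp add: \<phi>_def)
  then show False using \<open>T \<in> S\<close> by (simp add: S_def)
qed

section \<open>Derivatives, zeros and primitives\<close>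

definition vec_deriv :: "(complex \<Rightarrow> complex ^ 'n) \<Rightarrow> complex \<Rightarrow> complex ^ 'n"
  where "vec_deriv f z = (\<chi> i. deriv (\<lambda>w. f w $ i) z)"

lemma vec_deriv_eqI: "has_vec_deriv f v z \<Longrightarrow> vec_deriv f z = v"
  by (auto simp: has_vec_deriv_component_iff vec_deriv_def vec_eq_iff intro: DERIV_imp_deriv)

lemma has_vec_deriv_vec_deriv:
  "vec_holomorphic_on f S \<Longrightarrow> z \<in> S \<Longrightarrow> has_vec_deriv f (vec_deriv f z) z"
  unfolding vec_holomorphic_on_def by (metis vec_deriv_eqI)

lemma vec_holomorphic_onI:
  "(\<And>z. z \<in> S \<Longrightarrow> has_vec_deriv f (f' z) z) \<Longrightarrow> vec_holomorphic_on f S"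
  by (auto simp: vec_holomorphic_on_def)

lemma has_vec_deriv_diff:
  "has_vec_deriv f v z \<Longrightarrow> has_vec_deriv g w z \<Longrightarrow> has_vec_deriv (\<lambda>z. f z - g z) (v - w) z"
  by (auto simp: has_vec_deriv_component_iff intro: DERIV_diff)

lemma has_vec_deriv_add:
  "has_vec_deriv f v z \<Longrightarrow> has_vec_deriv g w z \<Longrightarrow> has_vec_deriv (\<lambda>z. f z + g z) (v + w) z"
  by (auto simp: has_vec_deriv_component_iff intro: DERIV_add)

lemma has_vec_deriv_smult_left:
  "(a has_field_derivative b) (at z) \<Longrightarrow> has_vec_deriv (\<lambda>z. a z *s v) (b *s v) z"
  by (auto simp: has_vec_deriv_component_iff intro: DERIV_cmult_right)

lemma vec_holomorphic_on_subset:
  "vec_holomorphic_on f S \<Longrightarrow> T \<subseteq> S \<Longrightarrow> vec_holomorphic_on f T"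
  by (auto simp: vec_holomorphic_on_def)

lemma vec_holomorphic_on_diff:
  "vec_holomorphic_on f S \<Longrightarrow> vec_holomorphic_on g S \<Longrightarrow> vec_holomorphic_on (\<lambda>z. f z - g z) S"
  unfolding vec_holomorphic_on_def by (fast intro: has_vec_deriv_diff)

lemma vec_holomorphic_on_imp_continuous:
  "vec_holomorphic_on f S \<Longrightarrow> z \<in> S \<Longrightarrow> isCont f z"
  unfolding vec_holomorphic_on_def has_vec_deriv_def
  by (meson has_derivative_continuous)

lemma vec_holomorphic_on_vec_deriv:
  assumes "open S" "vec_holomorphic_on f S"
  shows "vec_holomorphic_on (vec_deriv f) S"
  using assms unfolding vec_holomorphic_on_component_iff[OF assms(1)] vec_deriv_def
  by (auto intro: holomorphic_deriv)

lemma vec_holomorphic_on_smult: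
  assumes "open S" "a holomorphic_on S" "vec_holomorphic_on f S"
  shows "vec_holomorphic_on (\<lambda>z. a z *s f z) S"
  using assms unfolding vec_holomorphic_on_component_iff[OF assms(1)]
  by (auto intro: holomorphic_intros)

text \<open>Being o(z^N) forces a zero of order N + 1. One factor \<open>z\<close> is split off at a
  time by removing the singularity of the quotient, which keeps the quotient holomorphic on the same
  ball.\<close>

lemma holomorphic_ball_factor_power:
  assumes "0 < r" "h holomorphic_on ball 0 r" "((\<lambda>z. h z / z ^ N) \<longlongrightarrow> 0) (at 0)"
  shows "\<exists>k. k holomorphic_on ball 0 r \<and> (\<forall>z\<in>ball 0 r. h z = z ^ Suc N * k z)"
  using assms(3)
proof (induction N)
  have factor: "\<exists>k. k holomorphic_on ball 0 r \<and> (\<forall>z\<in>ball 0 r. g z = z * k z)"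
    if g: "g holomorphic_on ball 0 r" "(g \<longlongrightarrow> 0) (at 0)" for g
  proof -
    have "isCont g 0"
      using continuous_on_interior[OF holomorphic_on_imp_continuous_on[OF g(1)], of 0] \<open>0 < r\<close> by simp
    then have "g 0 = 0" using g(2) by (metis LIM_unique isCont_def)
    have "(\<lambda>z. if z = 0 then deriv g 0 else g z / z - g 0 / (z - 0)) holomorphic_on ball 0 r"
      by (rule pole_theorem_open[OF g(1)]) auto
    then show ?thesis
      using \<open>g 0 = 0\<close> by (intro exI[of _ "\<lambda>z. if z = 0 then deriv g 0 else g z / z - g 0 / (z - 0)"]) auto
  qed
  {
    case 0
    then show ?case using factor[of h] assms by simp
  next
    case (Suc N)
    have "((\<lambda>z. (h z / z ^ Suc N) * z) \<longlongrightarrow> 0 * 0) (at 0)"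
      by (intro tendsto_mult Suc.prems tendsto_ident_at)
    then have "((\<lambda>z. h z / z ^ N) \<longlongrightarrow> 0) (at 0)"
      by (rule Lim_transform_eventually[THEN filterlim_mono]) (auto simp: eventually_at_filter)
    then obtain k where k: "k holomorphic_on ball 0 r" "\<forall>z\<in>ball 0 r. h z = z ^ Suc N * k z"
      using Suc.IH by blast
    have "\<forall>\<^sub>F z in at 0. z \<in> ball 0 r - {0::complex}"
      using \<open>0 < r\<close> by (auto simp: eventually_at_filter intro: eventually_nhds_in_open eventually_mono[OF eventually_nhds_in_open[of "ball 0 r"]])
    then have "\<forall>\<^sub>F z in at 0. h z / z ^ Suc N = k z"
      by eventually_elim (use k in auto)
    then have "(k \<longlongrightarrow> 0) (at 0)" using Suc.prems Lim_transform_eventually by blast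
    then obtain k' where "k' holomorphic_on ball 0 r" "\<forall>z\<in>ball 0 r. k z = z * k' z"
      using factor k by blast
    then show ?case using k by (intro exI[of _ k']) (auto simp: algebra_simps)
  }
qed

text \<open>Since \<open>q\<close> vanishes at 0, q(z)/z extends holomorphically, and its primitive
  vanishing at 0 inverts the operator z d/dz.\<close>

lemma euler_primitive_exists:
  assumes "0 < r" "vec_holomorphic_on q (ball 0 r)" "q 0 = 0"
  shows "\<exists>g. vec_holomorphic_on g (ball 0 r) \<and> g 0 = 0 \<and>
    (\<forall>z\<in>ball 0 r. z *s vec_deriv g z = q z)"
proof -
  have "\<exists>g. g 0 = 0 \<and> (\<forall>z\<in>ball 0 r. \<exists>g'. (g has_field_derivative g') (at z) \<and> z * g' = q z $ i)" for i
  proof -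
    have hol: "(\<lambda>z. q z $ i) holomorphic_on ball 0 r"
      using assms by (auto simp: vec_holomorphic_on_component_iff)
    have "((\<lambda>z. q z $ i) \<longlongrightarrow> 0) (at 0)"
      using continuous_on_interior[OF holomorphic_on_imp_continuous_on[OF hol], of 0] assms
      by (simp add: isCont_def)
    then obtain k where k: "k holomorphic_on ball 0 r" "\<forall>z\<in>ball 0 r. q z $ i = z * k z"
      using holomorphic_ball_factor_power[OF assms(1) hol, of 0] by auto
    obtain g where g: "\<And>z. z \<in> ball 0 r \<Longrightarrow> (g has_field_derivative k z) (at z within ball 0 r)"
      using holomorphic_convex_primitive'[OF _ _ k(1)] by auto
    have "((\<lambda>z. g z - g 0) has_field_derivative k z) (at z)" if "z \<in> ball 0 r" for z
      using DERIV_diff[OF g[OF that] DERIV_const[of "g 0"]] that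
      by (simp only: at_within_open[OF that open_ball] diff_zero)
    then show ?thesis using k(2) by (intro exI[of _ "\<lambda>z. g z - g 0"]) (metis diff_self)
  qed
  then obtain g where g: "\<And>i. g i 0 = 0"
    "\<And>i z. z \<in> ball 0 r \<Longrightarrow> \<exists>g'. (g i has_field_derivative g') (at z) \<and> z * g' = q z $ i"
    by metis
  define G where "G z = (\<chi> i. g i z)" for z
  have "vec_holomorphic_on G (ball 0 r)"
    using g(2) unfolding vec_holomorphic_on_component_iff[OF open_ball] G_def
    by (auto simp: holomorphic_on_open, blast)
  moreover have "z *s vec_deriv G z = q z" if "z \<in> ball 0 r" for z
    using g(2)[OF that] by (auto simp: vec_eq_iff vec_deriv_def G_def dest!: DERIV_imp_deriv)
  ultimately show ?thesis using g(1) by (intro exI[of _ G]) (auto simp: G_def vec_eq_iff)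
qed

text \<open>On the segment from 0 to \<open>z\<close> the derivative is bounded by a multiple of
  s^(N-1), and integrating this power of s produces the gain 1/N.\<close>

lemma euler_primitive_bound:
  assumes "vec_holomorphic_on g (ball 0 r)" "g 0 = 0" "1 \<le> N"
    and bound: "\<And>z. z \<in> ball 0 r \<Longrightarrow> norm (z *s vec_deriv g z) \<le> B * norm z ^ N"
    and z: "z \<in> ball 0 r"
  shows "norm (g z) \<le> B / N * norm z ^ N"
proof -
  have seg: "complex_of_real s * z \<in> ball 0 r" if "0 \<le> s" "s \<le> 1" for s
    using z that by (auto simp: norm_mult intro: le_less_trans[OF mult_left_le_one_le])
  have deriv: "((\<lambda>s. g (of_real s * z)) has_vector_derivative z *s vec_deriv g (of_real s * z)) (at s)"
    if "0 \<le> s" "s \<le> 1" for s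
  proof -
    have "(g has_derivative (\<lambda>h. h *s vec_deriv g (of_real s * z))) (at (of_real s * z))"
      using has_vec_deriv_vec_deriv[OF assms(1) seg[OF that]] by (simp add: has_vec_deriv_def)
    moreover have "((\<lambda>s. of_real s * z) has_derivative (\<lambda>h. of_real h * z)) (at s)"
      by (intro bounded_linear_imp_has_derivative) (simp add: bounded_linear_mult_const bounded_linear_of_real bounded_linear_mult_left)
    ultimately show ?thesis
      unfolding has_vector_derivative_def
      by (auto dest!: has_derivative_compose simp: scaleR_eq_smult o_def)
  qed
  have "norm (g (of_real 1 * z) - g (of_real 0 * z)) \<le> B / N * norm z ^ N * 1 ^ N - B / N * norm z ^ N * 0 ^ N"
  proof (rule differentiable_bound_general[where f = "\<lambda>s. g (of_real s * z)" and
        \<phi> = "\<lambda>s. B / N * norm z ^ N * s ^ N" and \<phi>' = "\<lambda>s. B * norm z ^ N * s ^ (N - 1)"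
        and f' = "\<lambda>s. z *s vec_deriv g (of_real s * z)"])
    show "continuous_on {0..1} (\<lambda>s. g (of_real s * z))"
      by (intro continuous_at_imp_continuous_on ballI has_vector_derivative_continuous[OF deriv]) auto
    show "continuous_on {0..1} (\<lambda>s. B / N * norm z ^ N * s ^ N)" by (intro continuous_intros)
    fix s :: real assume s: "0 < s" "s < 1"
    show "((\<lambda>s. g (of_real s * z)) has_vector_derivative z *s vec_deriv g (of_real s * z)) (at s)"
      using deriv s by auto
    show "((\<lambda>s. B / N * norm z ^ N * s ^ N) has_vector_derivative B * norm z ^ N * s ^ (N - 1)) (at s)"
      unfolding has_real_derivative_iff_has_vector_derivative[symmetric]
      using \<open>1 \<le> N\<close> by (auto intro!: derivative_eq_intros)
    \<comment> \<open>The hypothesis at the point s z carries the factor s z, not z; cancelling this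
      s leaves the exponent N - 1.\<close>
    have "s * norm (z *s vec_deriv g (of_real s * z)) \<le> B * norm z ^ N * s ^ N"
      using bound[OF seg[of s]] s by (simp add: norm_smult_vec norm_mult power_mult_distrib mult_ac)
    also have "s ^ N = s * s ^ (N - 1)" using \<open>1 \<le> N\<close> by (cases N) auto
    finally show "norm (z *s vec_deriv g (of_real s * z)) \<le> B * norm z ^ N * s ^ (N - 1)"
      using s by (simp add: mult.left_commute[of _ s])
  qed auto
  then show ?thesis using assms(2,3) by (simp add: power_0_left)
qed

text \<open>Only differentiability of \<open>X\<close> is assumed, so the bound on the derivative of the remainder
  near \<open>0\<close> comes from Cauchy's inequality on complex lines.\<close>

lemma holomorphic_map_remainder_lipschitz:
  fixes X :: "complex ^ 'n \<Rightarrow> complex ^ 'n"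
  assumes "open W" "0 \<in> W" "holomorphic_map_on X W" "X 0 = 0"
    and D: "(X has_derivative D) (at 0)" and "0 < \<epsilon>"
  shows "\<exists>\<delta>>0. ball 0 \<delta> \<subseteq> W \<and> (\<forall>x\<in>ball 0 \<delta>. \<forall>y\<in>ball 0 \<delta>.
    norm ((X x - D x) - (X y - D y)) \<le> \<epsilon> * norm (x - y))"
proof -
  \<comment> \<open>Cauchy's inequality below costs a factor 4 for each component, and summing the
    components costs \<open>CARD('n)\<close>.\<close>
  define e where "e = \<epsilon> / (4 * CARD('n))"
  have "0 < e" using \<open>0 < \<epsilon>\<close> by (simp add: e_def)
  then obtain d where d: "0 < d" "\<And>y. norm y < d \<Longrightarrow> norm (X y - D y) \<le> e * norm y"
    using D \<open>X 0 = 0\<close> unfolding has_derivative_at_alt by force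
  obtain d' where d': "0 < d'" "ball 0 d' \<subseteq> W"
    using assms by (meson openE)
  define \<delta> where "\<delta> = min d d' / 2"
  have \<delta>: "0 < \<delta>" "2 * \<delta> \<le> d" "ball 0 (2 * \<delta>) \<subseteq> W"
    using d d' by (auto simp: \<delta>_def)
  obtain D0 where D0: "Vector_Spaces.linear (*s) (*s) D0" "(X has_derivative D0) (at 0)"
    using assms by (auto simp: holomorphic_map_on_def)
  have "D0 = D" using has_derivative_unique[OF D0(2) D] .
  then interpret D: Vector_Spaces.linear "(*s)" "(*s)" D using D0(1) by (simp only:)
  have "\<exists>D'. (X has_derivative D') (at x) \<and> (\<forall>h. norm (D' h - D h) \<le> \<epsilon> * norm h)"
    if x: "x \<in> ball 0 \<delta>" for x
  proof -
    have "x \<in> ball 0 (2 * \<delta>)" using x \<delta>(1) by simp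
    then have "x \<in> W" using \<delta>(3) by blast
    obtain D' where D': "Vector_Spaces.linear (*s) (*s) D'" "(X has_derivative D') (at x)"
      using assms(3) \<open>x \<in> W\<close> unfolding holomorphic_map_on_def by blast
    interpret D': Vector_Spaces.linear "(*s)" "(*s)" D' by fact
    have "norm (D' h - D h) \<le> \<epsilon> * norm h" if "h \<noteq> 0" for h
    proof -
      \<comment> \<open>For \<open>norm \<zeta> < 2 * \<rho>\<close> the displacement is shorter
        than \<open>\<delta>\<close>, so the complex line through \<open>x\<close> stays in the ball
        of radius \<open>2 * \<delta>\<close>, where the first order estimate holds.\<close>
      define \<rho> where "\<rho> = \<delta> / (2 * norm h)"
      have "0 < \<rho>" using \<delta> that by (simp add: \<rho>_def)
      have near: "x + \<zeta> *s h \<in> ball 0 (2 * \<delta>)" if "norm \<zeta> < 2 * \<rho>" for \<zeta>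
      proof -
        have "norm (\<zeta> *s h) < \<delta>" 
          using that \<open>h \<noteq> 0\<close> by (simp add: norm_smult_vec \<rho>_def field_simps)
        then show ?thesis using x norm_triangle_ineq[of x "\<zeta> *s h"] by auto
      qed
      define \<psi> where "\<psi> \<zeta> = X (x + \<zeta> *s h) - (D x + \<zeta> *s D h)" for \<zeta>
      have \<psi>_eq: "\<psi> \<zeta> = X (x + \<zeta> *s h) - D (x + \<zeta> *s h)" for \<zeta>
        by (simp add: \<psi>_def D.add D.scale)
      have line: "has_vec_deriv (\<lambda>\<zeta>. y + \<zeta> *s k) k z" for y k :: "complex ^ 'n" and z
        using has_vec_deriv_add[OF _ has_vec_deriv_smult_left[OF DERIV_ident], of "\<lambda>_. y" 0]
        by (auto simp: has_vec_deriv_def)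
      have hol: "vec_holomorphic_on \<psi> (ball 0 (2 * \<rho>))"
        unfolding \<psi>_def
      proof (intro vec_holomorphic_on_diff holomorphic_map_on_comp_vec[OF assms(3)])
        show "(\<lambda>\<zeta>. x + \<zeta> *s h) ` ball 0 (2 * \<rho>) \<subseteq> W" using near \<delta> by auto
      qed (auto simp: vec_holomorphic_on_def intro: line)
      have X_line: "has_vec_deriv (\<lambda>\<zeta>. X (x + \<zeta> *s h)) (D' h) 0"
        using has_derivative_compose[of "\<lambda>\<zeta>. x + \<zeta> *s h" "\<lambda>\<zeta>. \<zeta> *s h" 0 UNIV X D'] D' line[of x h 0]
        by (simp add: has_vec_deriv_def D'.scale)
      have deriv: "has_vec_deriv \<psi> (D' h - D h) 0"
        unfolding \<psi>_def by (intro has_vec_deriv_diff X_line line)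
      have "norm ((D' h - D h) $ i) \<le> 4 * e * norm h" for i
      proof -
        have hol_i: "(\<lambda>\<zeta>. \<psi> \<zeta> $ i) holomorphic_on ball 0 (2 * \<rho>)"
          using hol by (auto simp: vec_holomorphic_on_component_iff)
        have "norm ((deriv ^^ 1) (\<lambda>\<zeta>. \<psi> \<zeta> $ i) 0) \<le> fact 1 * (e * (2 * \<delta>)) / \<rho> ^ 1"
        proof (rule Cauchy_inequality)
          show "(\<lambda>\<zeta>. \<psi> \<zeta> $ i) holomorphic_on ball 0 \<rho>"
            using hol_i \<open>0 < \<rho>\<close> by (auto elim: holomorphic_on_subset)
          show "continuous_on (cball 0 \<rho>) (\<lambda>\<zeta>. \<psi> \<zeta> $ i)"
            using holomorphic_on_imp_continuous_on[OF hol_i] \<open>0 < \<rho>\<close> by (auto elim: continuous_on_subset)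
          fix \<zeta> :: complex assume "norm (0 - \<zeta>) = \<rho>"
          then have n: "norm (x + \<zeta> *s h) < 2 * \<delta>" using near[of \<zeta>] \<open>0 < \<rho>\<close> by auto
          have "norm (\<psi> \<zeta> $ i) \<le> norm (\<psi> \<zeta>)" by (rule Finite_Cartesian_Product.norm_nth_le)
          also have "\<dots> \<le> e * norm (x + \<zeta> *s h)"
            unfolding \<psi>_eq using n \<delta> by (intro d) auto
          also have "\<dots> \<le> e * (2 * \<delta>)" using n \<open>0 < e\<close> by (intro mult_left_mono) auto
          finally show "norm (\<psi> \<zeta> $ i) \<le> e * (2 * \<delta>)" .
        qed fact
        moreover have "deriv (\<lambda>\<zeta>. \<psi> \<zeta> $ i) 0 = (D' h - D h) $ i"
          using deriv by (auto simp: has_vec_deriv_component_iff intro!: DERIV_imp_deriv)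
        moreover have "e * (2 * \<delta>) / \<rho> = 4 * e * norm h" using \<delta> \<open>h \<noteq> 0\<close> by (simp add: \<rho>_def)
        ultimately show ?thesis by simp
      qed
      then have "(\<Sum>i\<in>UNIV. norm ((D' h - D h) $ i)) \<le> (\<Sum>i\<in>(UNIV::'n set). 4 * e * norm h)"
        by (intro sum_mono)
      also have "\<dots> = \<epsilon> * norm h" by (simp add: e_def)
      finally show ?thesis using norm_le_sum_components[of "D' h - D h"] by linarith
    qed
    then have "norm (D' h - D h) \<le> \<epsilon> * norm h" for h
      by (cases "h = 0") auto
    then show ?thesis using D' by blast
  qed
  then obtain D' where D': "\<And>x. x \<in> ball 0 \<delta> \<Longrightarrow> (X has_derivative D' x) (at x)"
    "\<And>x h. x \<in> ball 0 \<delta> \<Longrightarrow> norm (D' x h - D h) \<le> \<epsilon> * norm h"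
    by metis
  have "norm ((X x - D x) - (X y - D y)) \<le> \<epsilon> * norm (x - y)"
    if "x \<in> ball 0 \<delta>" "y \<in> ball 0 \<delta>" for x y
  proof (rule differentiable_bound[where S = "ball 0 \<delta>" and f' = "\<lambda>x h. D' x h - D h"])
    fix x assume x: "x \<in> ball (0 :: complex ^ 'n) \<delta>"
    have "bounded_linear D" using D by (rule has_derivative_bounded_linear)
    then show "((\<lambda>x. X x - D x) has_derivative (\<lambda>h. D' x h - D h)) (at x within ball 0 \<delta>)"
      using D'(1)[OF x] by (intro has_derivative_diff bounded_linear_imp_has_derivative) (auto intro: has_derivative_at_withinI)
    show "onorm (\<lambda>h. D' x h - D h) \<le> \<epsilon>"
      using D'(2)[OF x] by (intro onorm_bound) (use \<open>0 < \<epsilon>\<close> in auto)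
  qed (use that in auto)
  moreover have "ball 0 \<delta> \<subseteq> W" using \<delta> by auto
  ultimately show ?thesis using \<delta> by blast
qed

lemma vec_holomorphic_ball_factor_power:
  fixes h :: "complex \<Rightarrow> complex ^ 'n"
  assumes "0 < r" "vec_holomorphic_on h (ball 0 r)"
    and lim: "((\<lambda>z. norm (h z) / norm z ^ N) \<longlongrightarrow> 0) (at 0)"
  shows "\<exists>k. vec_holomorphic_on k (ball 0 r) \<and> (\<forall>z\<in>ball 0 r. h z = z ^ Suc N *s k z)"
proof -
  have "\<exists>k. k holomorphic_on ball 0 r \<and> (\<forall>z\<in>ball 0 r. h z $ i = z ^ Suc N * k z)" for i
  proof (rule holomorphic_ball_factor_power[OF assms(1)])
    show "(\<lambda>z. h z $ i) holomorphic_on ball 0 r"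
      using assms by (auto simp: vec_holomorphic_on_component_iff)
    show "((\<lambda>z. h z $ i / z ^ N) \<longlongrightarrow> 0) (at 0)"
    proof (rule Lim_null_comparison[OF always_eventually lim], rule allI)
      show "norm (h z $ i / z ^ N) \<le> norm (h z) / norm z ^ N" for z
        using Finite_Cartesian_Product.norm_nth_le[of "h z" i]
        by (simp add: norm_divide norm_power divide_right_mono)
    qed
  qed
  then obtain k where k: "\<And>i. k i holomorphic_on ball 0 r"
    "\<And>i z. z \<in> ball 0 r \<Longrightarrow> h z $ i = z ^ Suc N * k i z"
    by metis
  show ?thesis
    by (intro exI[of _ "\<lambda>z. \<chi> i. k i z"])
      (use k in \<open>auto simp: vec_holomorphic_on_component_iff vec_eq_iff\<close>)
qed

section \<open>Separatrices\<close>

locale singular_vector_field =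
  fixes X D :: "complex ^ 'n \<Rightarrow> complex ^ 'n" and W :: "(complex ^ 'n) set"
  assumes open_W: "open W" and zero_in_W: "0 \<in> W" and holomorphic_X: "holomorphic_map_on X W"
    and X_zero: "X 0 = 0" and deriv_X: "(X has_derivative D) (at 0)"
    and linear_D: "Vector_Spaces.linear (*s) (*s) D"
begin

sublocale D: Vector_Spaces.linear "(*s)" "(*s)" D by (rule linear_D)

lemmas bounded_linear_D = has_derivative_bounded_linear[OF deriv_X]

lemmas remainder_lipschitz =
  holomorphic_map_remainder_lipschitz[OF open_W zero_in_W holomorphic_X X_zero deriv_X]

lemma X_lipschitz:
  "\<exists>c\<ge>0. \<exists>\<delta>>0. ball 0 \<delta> \<subseteq> W \<and>
    (\<forall>x\<in>ball 0 \<delta>. \<forall>y\<in>ball 0 \<delta>. norm (X x - X y) \<le> c * norm (x - y))"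
proof -
  obtain \<delta> where \<delta>: "0 < \<delta>" "ball 0 \<delta> \<subseteq> W" "\<And>x y. x \<in> ball 0 \<delta> \<Longrightarrow> y \<in> ball 0 \<delta> \<Longrightarrow>
      norm ((X x - D x) - (X y - D y)) \<le> 1 * norm (x - y)"
    using remainder_lipschitz[of 1] by auto
  have "norm (X x - X y) \<le> (1 + onorm D) * norm (x - y)" if "x \<in> ball 0 \<delta>" "y \<in> ball 0 \<delta>" for x y
  proof -
    have "X x - X y = ((X x - D x) - (X y - D y)) + D (x - y)"
      by (simp add: D.diff)
    also have "norm \<dots> \<le> 1 * norm (x - y) + onorm D * norm (x - y)"
      by (intro norm_triangle_mono \<delta> that onorm bounded_linear_D)
    finally show ?thesis by (simp add: algebra_simps)
  qed
  then show ?thesis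
    using \<delta> onorm_pos_le[OF bounded_linear_D] by (intro exI[of _ "1 + onorm D"]) auto
qed

text \<open>Residual of the Briot-Bouquet equation. Its order of vanishing at 0 tells up to which
  order \<open>p\<close> is a formal solution.\<close>

definition defect :: "complex \<Rightarrow> (complex \<Rightarrow> complex ^ 'n) \<Rightarrow> complex \<Rightarrow> complex ^ 'n"
  where "defect \<nu> p z = (\<nu> * z) *s vec_deriv p z - X (p z)"

lemma vec_holomorphic_on_defect:
  assumes "open S" "vec_holomorphic_on p S" "p ` S \<subseteq> W"
  shows "vec_holomorphic_on (defect \<nu> p) S"
  unfolding defect_def
  by (intro vec_holomorphic_on_diff vec_holomorphic_on_smult vec_holomorphic_on_vec_deriv
      holomorphic_map_on_comp_vec[OF holomorphic_X] holomorphic_intros assms)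

lemma ball_mapped_into_open:
  assumes "isCont p 0" "p 0 \<in> U" "open U" "0 < s"
  shows "\<exists>r>0. r \<le> s \<and> p ` ball 0 r \<subseteq> U"
proof -
  have "\<forall>\<^sub>F z in nhds 0. p z \<in> U"
    using assms(1-3) by (metis isCont_def tendsto_at_iff_tendsto_nhds topological_tendstoD)
  then obtain r where "0 < r" "\<And>z. dist z 0 < r \<Longrightarrow> p z \<in> U"
    unfolding eventually_nhds_metric by blast
  then show ?thesis using \<open>0 < s\<close> by (intro exI[of _ "min r s"]) (auto simp: dist_commute)
qed

text \<open>The formal solution is built one coefficient at a time, without a Taylor expansion of
  \<open>X\<close>. Adding a term of order N with coefficient c changes the order N part of the
  defect by \<open>N \<nu> c - D c\<close>, and nonresonance lets this take any prescribed value.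
  The nonlinear part of \<open>X\<close> does not interfere, since its Lipschitz constant tends to 0
  near the origin.\<close>

lemma approximate_separatrix:
  assumes v: "D v = \<nu> *s v"
    and nonres: "\<forall>k\<ge>2. \<forall>w. D w = (of_nat k * \<nu>) *s w \<longrightarrow> w = 0"
  shows "\<exists>r>0. \<exists>p. vec_holomorphic_on p (ball 0 r) \<and> p 0 = 0 \<and> vec_deriv p 0 = v \<and>
    p ` ball 0 r \<subseteq> W \<and> ((\<lambda>z. norm (defect \<nu> p z) / norm z ^ Suc n) \<longlongrightarrow> 0) (at 0)"
proof (induction n)
  case 0
  define p where "p = (\<lambda>z. z *s v)"
  have p: "has_vec_deriv p v z" for z
    using has_vec_deriv_smult_left[OF DERIV_ident] by (simp add: p_def)
  then have hol: "vec_holomorphic_on p S" for S by (auto simp: vec_holomorphic_on_def)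
  obtain r where r: "0 < r" "p ` ball 0 r \<subseteq> W"
    using ball_mapped_into_open[of p W 1] vec_holomorphic_on_imp_continuous[OF hol[of UNIV]] open_W zero_in_W
    by (auto simp: p_def)
  \<comment> \<open>For the linear curve the defect is, up to sign, the first order remainder of
    \<open>X\<close> along \<open>v\<close>, because \<open>v\<close> is an eigenvector. So the base
    case is just differentiability at 0.\<close>
  have "((\<lambda>z. X (p z)) has_derivative (\<lambda>h. D (h *s v))) (at 0)"
    using has_derivative_compose[of p "\<lambda>h. h *s v" 0 UNIV X D] p[of 0] deriv_X
    by (simp add: has_vec_deriv_def p_def)
  then have "((\<lambda>z. norm (X (p z) - X (p 0) - D ((z - 0) *s v)) / norm (z - 0)) \<longlongrightarrow> 0) (at 0)"
    unfolding has_derivative_iff_norm by blast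
  also have "(\<lambda>z. norm (X (p z) - X (p 0) - D ((z - 0) *s v)) / norm (z - 0)) =
      (\<lambda>z. norm (defect \<nu> p z) / norm z ^ Suc 0)"
    by (simp add: defect_def vec_deriv_eqI[OF p] D.scale v X_zero norm_minus_commute)
      (simp add: p_def X_zero mult.commute norm_minus_commute)
  finally show ?case
    using r hol p[THEN vec_deriv_eqI] by (intro exI[of _ r] conjI exI[of _ p]) (auto simp: p_def)
next
  case (Suc n)
  let ?N = "Suc (Suc n)"
  obtain r p where r: "0 < r" and p: "vec_holomorphic_on p (ball 0 r)" "p 0 = 0"
    "vec_deriv p 0 = v" "p ` ball 0 r \<subseteq> W"
    "((\<lambda>z. norm (defect \<nu> p z) / norm z ^ Suc n) \<longlongrightarrow> 0) (at 0)"
    using Suc.IH by blast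
  obtain e where e: "vec_holomorphic_on e (ball 0 r)"
    "\<And>z. z \<in> ball 0 r \<Longrightarrow> defect \<nu> p z = z ^ ?N *s e z"
    using vec_holomorphic_ball_factor_power[OF r vec_holomorphic_on_defect[OF open_ball p(1,4)] p(5)]
    by blast
  \<comment> \<open>A defect that is o(z^(n+1)) starts at order \<open>?N = n + 2\<close>, which is
    at least 2. Hence nonresonance makes \<open>K\<close> injective, and in finite dimension
    surjective.\<close>
  define K where "K = (\<lambda>w. D w - (of_nat ?N * \<nu>) *s w)"
  interpret K: Vector_Spaces.linear "(*s)" "(*s)" K
    by unfold_locales (auto simp: K_def D.add D.scale vec_eq_iff algebra_simps)
  have "w = 0" if "K w = 0" for w
    using that nonres[rule_format, of ?N w] by (simp add: K_def)
  then have "inj K" by (simp add: K.inj_iff_eq_0)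
  then have "surj K" using vec.linear_inj_imp_surj[OF K.linear_axioms] by blast
  then obtain c where c: "K c = e 0" by (metis surjD)
  define p' where "p' = (\<lambda>z. p z + z ^ ?N *s c)"
  have p': "has_vec_deriv p' (vec_deriv p z + (of_nat ?N * z ^ Suc n) *s c) z" if "z \<in> ball 0 r" for z
    unfolding p'_def
    using DERIV_power[OF DERIV_ident, of ?N z UNIV]
    by (intro has_vec_deriv_add has_vec_deriv_smult_left has_vec_deriv_vec_deriv[OF p(1) that])
      (simp add: algebra_simps)
  then have hol: "vec_holomorphic_on p' (ball 0 r)" by (rule vec_holomorphic_onI)
  then have cont: "isCont p' 0" using vec_holomorphic_on_imp_continuous r by force
  have cont_p: "isCont p 0" using vec_holomorphic_on_imp_continuous[OF p(1)] r by force
  have "p' 0 = 0" using p by (simp add: p'_def)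
  obtain s where s: "0 < s" "s \<le> r" "p' ` ball 0 s \<subseteq> W"
    using ball_mapped_into_open[OF cont _ open_W r] zero_in_W \<open>p' 0 = 0\<close> by auto
  \<comment> \<open>The choice of \<open>c\<close> has cancelled the leading coefficient
    \<open>e 0\<close>. The first term is small by continuity of \<open>e\<close>, the second by the
    Lipschitz bound on the remainder, as \<open>p'\<close> and \<open>p\<close> differ by a term of
    order \<open>?N\<close>.\<close>
  have defect': "defect \<nu> p' z = z ^ ?N *s (e z - e 0) - ((X (p' z) - D (p' z)) - (X (p z) - D (p z)))"
    if z: "z \<in> ball 0 r" for z
  proof -
    have "(\<nu> * z) *s vec_deriv p z = z ^ ?N *s e z + X (p z)"
      using e(2)[OF z] by (simp add: defect_def algebra_simps)
    moreover have "D (p' z) = D (p z) + z ^ ?N *s D c" by (simp add: p'_def D.add D.scale)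
    moreover have "D c = e 0 + (of_nat ?N * \<nu>) *s c" using c by (simp add: K_def algebra_simps)
    moreover have "(\<nu> * z) *s ((of_nat ?N * z ^ Suc n) *s c) = z ^ ?N *s ((of_nat ?N * \<nu>) *s c)"
      by (simp add: vec_eq_iff)
    ultimately show ?thesis
      unfolding defect_def vec_deriv_eqI[OF p'[OF z]] vec.scale_right_distrib
      by (simp add: vec.scale_right_diff_distrib vec.scale_right_distrib)
  qed
  have "((\<lambda>z. norm (defect \<nu> p' z) / norm z ^ ?N) \<longlongrightarrow> 0) (at 0)"
  proof (rule tendstoI)
    fix \<epsilon> :: real assume "0 < \<epsilon>"
    \<comment> \<open>Half of \<open>\<epsilon>\<close> is reserved for \<open>e z - e 0\<close>;
      the added 1 covers \<open>c = 0\<close>.\<close>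
    define \<epsilon>' where "\<epsilon>' = \<epsilon> / (2 * (norm c + 1))"
    have pos: "0 < norm c + 1" using norm_ge_zero[of c] by linarith
    then have "0 < \<epsilon>'" using \<open>0 < \<epsilon>\<close> by (simp add: \<epsilon>'_def)
    have small: "\<epsilon>' * norm c < \<epsilon> / 2"
      using pos \<open>0 < \<epsilon>\<close> by (simp add: \<epsilon>'_def field_simps)
    obtain \<delta> where \<delta>: "0 < \<delta>" "\<And>x y. x \<in> ball 0 \<delta> \<Longrightarrow> y \<in> ball 0 \<delta> \<Longrightarrow>
        norm ((X x - D x) - (X y - D y)) \<le> \<epsilon>' * norm (x - y)"
      using remainder_lipschitz[OF \<open>0 < \<epsilon>'\<close>] by blast
    have "isCont e 0" using vec_holomorphic_on_imp_continuous[OF e(1)] r by force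
    then have "\<forall>\<^sub>F z in at 0. dist (e z) (e 0) < \<epsilon> / 2"
      using \<open>0 < \<epsilon>\<close> unfolding isCont_def by (intro tendstoD) auto
    moreover have "\<forall>\<^sub>F z in at 0. dist (p z) 0 < \<delta>"
      using cont_p p(2) \<delta>(1) unfolding isCont_def by (intro tendstoD) auto
    moreover have "\<forall>\<^sub>F z in at 0. dist (p' z) 0 < \<delta>"
      using cont \<open>p' 0 = 0\<close> \<delta>(1) unfolding isCont_def by (intro tendstoD) auto
    moreover have "\<forall>\<^sub>F z in at 0. dist z (0 :: complex) < r"
      using r by (intro tendstoD tendsto_ident_at)
    moreover have "\<forall>\<^sub>F z in at (0 :: complex). z \<noteq> 0"
      by (simp add: eventually_at_filter)
    ultimately show "\<forall>\<^sub>F z in at 0. dist (norm (defect \<nu> p' z) / norm z ^ ?N) 0 < \<epsilon>"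
    proof eventually_elim
      case (elim z)
      have "norm (defect \<nu> p' z) \<le> norm (z ^ ?N *s (e z - e 0)) + \<epsilon>' * norm (p' z - p z)"
        using elim defect'[of z] \<delta>(2)[of "p' z" "p z"]
          norm_triangle_ineq4[of "z ^ ?N *s (e z - e 0)" "(X (p' z) - D (p' z)) - (X (p z) - D (p z))"]
        by (auto simp: dist_commute)
      also have "\<dots> = norm z ^ ?N * (norm (e z - e 0) + \<epsilon>' * norm c)"
        unfolding norm_smult_vec p'_def by (simp add: norm_smult_vec norm_power distrib_left mult.left_commute del: power_Suc)
      also have "\<dots> < norm z ^ ?N * \<epsilon>"
        using elim small by (intro mult_strict_left_mono) (auto simp: dist_norm)
      finally have "norm (defect \<nu> p' z) < norm z ^ ?N * \<epsilon>" .
      then show ?case using elim by (simp add: pos_divide_less_eq mult.commute del: power_Suc)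
    qed
  qed
  moreover have "vec_deriv p' 0 = v"
    using vec_deriv_eqI[OF p'[of 0]] r p by simp
  moreover have "vec_holomorphic_on p' (ball 0 s)"
    using hol s by (auto intro: vec_holomorphic_on_subset)
  ultimately show ?case using s \<open>p' 0 = 0\<close> by blast
qed

text \<open>No small divisors occur: on maps that vanish to order \<open>N\<close> at \<open>0\<close> the operator
  \<open>z d/dz\<close> has an inverse of norm at most \<open>1 / N\<close>, which beats the Lipschitz constant of \<open>X\<close>
  once \<open>N\<close> is large. So Picard iteration starting at an approximate solution converges.\<close>

theorem separatrix_exists:
  assumes "\<nu> \<noteq> 0" and v: "D v = \<nu> *s v"
    and nonres: "\<forall>k\<ge>2. \<forall>w. D w = (of_nat k * \<nu>) *s w \<longrightarrow> w = 0"
  shows "\<exists>r>0. \<exists>f. vec_holomorphic_on f (ball 0 r) \<and> f 0 = 0 \<and> vec_deriv f 0 = v \<and>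
    f ` ball 0 r \<subseteq> W \<and> (\<forall>z\<in>ball 0 r. (\<nu> * z) *s vec_deriv f z = X (f z))"
proof -
  obtain c \<delta> where c: "0 \<le> c" and \<delta>: "0 < \<delta>" "ball 0 \<delta> \<subseteq> W"
    and lip: "\<And>x y. x \<in> ball 0 \<delta> \<Longrightarrow> y \<in> ball 0 \<delta> \<Longrightarrow> norm (X x - X y) \<le> c * norm (x - y)"
    using X_lipschitz by blast
  \<comment> \<open>Large enough for \<open>c * M\<close> to be at most 1/2, where \<open>M\<close>
    bounds the inverse of \<nu> z d/dz on maps of order \<open>N\<close>: Picard steps then contract
    by one half. Taking \<open>N\<close> two larger than \<open>n\<close> also secures that it is at
    least 2, which the derivative at 0 needs at the end.\<close>
  obtain n where n: "2 * c / norm \<nu> \<le> real n" using real_arch_simple by blast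
  define N where "N = Suc (Suc n)"
  have N: "1 \<le> N" by (simp add: N_def)
  define M where "M = 1 / (norm \<nu> * N)"
  have "0 < M" using \<open>\<nu> \<noteq> 0\<close> by (simp add: M_def N_def)
  have "2 * c / norm \<nu> \<le> N" using n by (simp add: N_def)
  then have cM: "c * M \<le> 1 / 2"
    using \<open>\<nu> \<noteq> 0\<close> N by (simp add: M_def field_simps)
  obtain r0 p where r0: "0 < r0" and p: "vec_holomorphic_on p (ball 0 r0)" "p 0 = 0"
    "vec_deriv p 0 = v" "p ` ball 0 r0 \<subseteq> W"
    and lim: "((\<lambda>z. norm (defect \<nu> p z) / norm z ^ N) \<longlongrightarrow> 0) (at 0)"
    using approximate_separatrix[OF v nonres, where n = "Suc n"] unfolding N_def by blast
  have "\<forall>\<^sub>F z in at 0. norm (defect \<nu> p z) / norm z ^ N < 1"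
    using order_tendstoD(2)[OF lim, of 1] by simp
  then have punctured: "\<forall>\<^sub>F z in at 0. norm (defect \<nu> p z) \<le> norm z ^ N"
    unfolding eventually_at_filter by eventually_elim (auto simp: divide_simps split: if_splits)
  have centre: "norm (defect \<nu> p 0) \<le> norm (0 :: complex) ^ N"
    using p N by (simp add: defect_def X_zero)
  have "\<forall>\<^sub>F z in nhds 0. norm (defect \<nu> p z) \<le> norm z ^ N"
    using punctured unfolding eventually_at_filter
    by (rule eventually_mono) (metis centre UNIV_I)
  moreover have "\<forall>\<^sub>F z in nhds 0. norm (p z) < \<delta> / 2"
  proof -
    have "isCont p 0" using vec_holomorphic_on_imp_continuous[OF p(1)] r0 by force
    then have "(p \<longlongrightarrow> 0) (nhds 0)" using p(2) unfolding isCont_def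
      by (metis tendsto_at_iff_tendsto_nhds)
    from tendstoD[OF this, of "\<delta> / 2"] \<delta>(1) show ?thesis by simp
  qed
  moreover have "\<forall>\<^sub>F z in nhds (0 :: complex). 2 * M * norm z ^ N < \<delta> / 2"
  proof -
    have "((\<lambda>z :: complex. 2 * M * norm z ^ N) \<longlongrightarrow> 2 * M * norm (0 :: complex) ^ N) (nhds 0)"
      by (intro tendsto_intros filterlim_ident)
    then have "((\<lambda>z :: complex. 2 * M * norm z ^ N) \<longlongrightarrow> 0) (nhds 0)"
      using N by (simp add: power_0_left)
    from order_tendstoD(2)[OF this, of "\<delta> / 2"] \<delta>(1) show ?thesis by simp
  qed
  moreover have "\<forall>\<^sub>F z in nhds (0 :: complex). z \<in> ball 0 r0"
    using r0 by (intro eventually_nhds_in_open) auto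
  ultimately have "\<forall>\<^sub>F z in nhds 0. norm (defect \<nu> p z) \<le> norm z ^ N \<and> norm (p z) < \<delta> / 2 \<and>
      2 * M * norm z ^ N < \<delta> / 2 \<and> z \<in> ball 0 r0"
    by eventually_elim auto
  then obtain r where r: "0 < r" and r': "\<And>z. dist z 0 < r \<Longrightarrow> norm (defect \<nu> p z) \<le> norm z ^ N \<and>
      norm (p z) < \<delta> / 2 \<and> 2 * M * norm z ^ N < \<delta> / 2 \<and> z \<in> ball 0 r0"
    unfolding eventually_nhds_metric by blast
  have def_le: "norm (defect \<nu> p z) \<le> norm z ^ N" and p_le: "norm (p z) < \<delta> / 2"
    and M_le: "2 * M * norm z ^ N < \<delta> / 2" if "z \<in> ball 0 r" for z
    using r'[of z] that by auto
  have hol_p: "vec_holomorphic_on p (ball 0 r)"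
    using p(1) r' by (auto intro!: vec_holomorphic_on_subset[of p "ball 0 r0"])
  \<comment> \<open>A weighted ball around \<open>p\<close>. With the defect of \<open>p\<close>
    bounded by \<open>norm z ^ N\<close>, a radius R is preserved by Picard steps if
    \<open>M * (c * R + 1)\<close> is at most R, and \<open>R = 2 * M\<close> satisfies this. Both
    \<open>p\<close> and the deviation from it stay below \<open>\<delta> / 2\<close>, so the
    Lipschitz bound applies throughout.\<close>
  define C where "C = {f. vec_holomorphic_on f (ball 0 r) \<and> f 0 = 0 \<and>
    (\<forall>z\<in>ball 0 r. norm (f z - p z) \<le> 2 * M * norm z ^ N)}"
  have near: "w \<in> ball 0 \<delta>" if "z \<in> ball 0 r" "norm (w - p z) \<le> 2 * M * norm z ^ N" for w z
    using that p_le[OF that(1)] M_le[OF that(1)] norm_triangle_ineq[of "w - p z" "p z"] by auto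
  have C_near: "f z \<in> ball 0 \<delta>" if "f \<in> C" "z \<in> ball 0 r" for f z
    using that near by (auto simp: C_def)
  have p_near: "p z \<in> ball 0 \<delta>" if "z \<in> ball 0 r" for z
    using near[OF that, of "p z"] \<open>0 < M\<close> by simp
  have improve: "norm (g z - h z) \<le> M * B * norm z ^ N"
    if g: "vec_holomorphic_on g (ball 0 r)" "g 0 = 0" and h: "vec_holomorphic_on h (ball 0 r)" "h 0 = 0"
      and bound: "\<And>z. z \<in> ball 0 r \<Longrightarrow>
        norm ((\<nu> * z) *s vec_deriv g z - (\<nu> * z) *s vec_deriv h z) \<le> B * norm z ^ N"
      and z: "z \<in> ball 0 r" for g h B z
  proof -
    have "norm (g z - h z) \<le> (B / norm \<nu>) / N * norm z ^ N"
    proof (rule euler_primitive_bound[where g = "\<lambda>z. g z - h z", OF _ _ N _ z])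
      fix z :: complex assume z: "z \<in> ball 0 r"
      have "vec_deriv (\<lambda>z. g z - h z) z = vec_deriv g z - vec_deriv h z"
        by (intro vec_deriv_eqI has_vec_deriv_diff has_vec_deriv_vec_deriv[OF g(1) z]
            has_vec_deriv_vec_deriv[OF h(1) z])
      then have "\<nu> *s (z *s vec_deriv (\<lambda>z. g z - h z) z) = (\<nu> * z) *s vec_deriv g z - (\<nu> * z) *s vec_deriv h z"
        by (simp add: vec.scale_right_diff_distrib)
      then have "norm \<nu> * norm (z *s vec_deriv (\<lambda>z. g z - h z) z) \<le> B * norm z ^ N"
        using bound[OF z] by (metis norm_smult_vec)
      then show "norm (z *s vec_deriv (\<lambda>z. g z - h z) z) \<le> B / norm \<nu> * norm z ^ N"
        using \<open>\<nu> \<noteq> 0\<close> by (simp add: field_simps)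
    qed (use g h in \<open>auto intro: vec_holomorphic_on_diff\<close>)
    also have "(B / norm \<nu>) / N = M * B" by (simp add: M_def)
    finally show ?thesis .
  qed
  \<comment> \<open>One Picard step: the new curve is the Euler primitive of X(f)/\<nu>.\<close>
  have "\<exists>g\<in>C. \<forall>z\<in>ball 0 r. (\<nu> * z) *s vec_deriv g z = X (f z)" if f: "f \<in> C" for f
  proof -
    have "f ` ball 0 r \<subseteq> W" using C_near[OF f] \<delta>(2) by blast
    then have "vec_holomorphic_on (\<lambda>z. (1 / \<nu>) *s X (f z)) (ball 0 r)"
      using f by (intro vec_holomorphic_on_smult holomorphic_map_on_comp_vec[OF holomorphic_X]) (auto simp: C_def)
    then obtain g where g: "vec_holomorphic_on g (ball 0 r)" "g 0 = 0"
      and g': "\<And>z. z \<in> ball 0 r \<Longrightarrow> z *s vec_deriv g z = (1 / \<nu>) *s X (f z)"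
      using euler_primitive_exists[OF r, of "\<lambda>z. (1 / \<nu>) *s X (f z)"] f by (auto simp: C_def X_zero)
    have eq: "(\<nu> * z) *s vec_deriv g z = X (f z)" if "z \<in> ball 0 r" for z
      using arg_cong[OF g'[OF that], of "(*s) \<nu>"] \<open>\<nu> \<noteq> 0\<close> by simp
    have "norm (g z - p z) \<le> M * (c * (2 * M) + 1) * norm z ^ N" if z: "z \<in> ball 0 r" for z
    proof (rule improve[OF g hol_p p(2) _ z])
      fix z :: complex assume z: "z \<in> ball 0 r"
      have "(\<nu> * z) *s vec_deriv g z - (\<nu> * z) *s vec_deriv p z = X (f z) - X (p z) - defect \<nu> p z"
        by (simp add: eq[OF z] defect_def)
      also have "norm \<dots> \<le> c * norm (f z - p z) + norm z ^ N"
        by (intro norm_triangle_ineq4[THEN order_trans] add_mono lip C_near[OF f] p_near def_le z)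
      also have "\<dots> \<le> c * (2 * M * norm z ^ N) + norm z ^ N"
        using f z c by (intro add_mono mult_left_mono) (auto simp: C_def)
      finally show "norm ((\<nu> * z) *s vec_deriv g z - (\<nu> * z) *s vec_deriv p z) \<le> (c * (2 * M) + 1) * norm z ^ N"
        by (simp add: algebra_simps)
    qed
    moreover have "M * (c * (2 * M) + 1) \<le> 2 * M"
      using cM \<open>0 < M\<close> mult_left_mono[of "c * M * 2 + 1" 2 M] by (simp add: mult_ac)
    ultimately have "norm (g z - p z) \<le> 2 * M * norm z ^ N" if "z \<in> ball 0 r" for z
      using that by (meson mult_right_mono norm_ge_zero order_trans zero_le_power)
    then show ?thesis using g eq by (auto simp: C_def)
  qed
  then obtain T where T: "\<And>f. f \<in> C \<Longrightarrow> T f \<in> C"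
    "\<And>f z. f \<in> C \<Longrightarrow> z \<in> ball 0 r \<Longrightarrow> (\<nu> * z) *s vec_deriv (T f) z = X (f z)"
    by metis
  define \<phi> where "\<phi> k = (T ^^ k) p" for k
  have "p \<in> C" using hol_p p(2) \<open>0 < M\<close> by (auto simp: C_def)
  then have \<phi>: "\<phi> k \<in> C" for k by (induction k) (auto simp: \<phi>_def T)
  have \<phi>_Suc: "\<phi> (Suc k) = T (\<phi> k)" for k by (simp add: \<phi>_def)
  have step: "norm (\<phi> (Suc k) z - \<phi> k z) \<le> 2 * M * (1 / 2) ^ k * norm z ^ N" if "z \<in> ball 0 r" for k z
    using that
  proof (induction k arbitrary: z)
    case 0
    then show ?case using \<phi>[of 1] by (auto simp: C_def \<phi>_def)
  next
    case (Suc k)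
    have "norm (\<phi> (Suc (Suc k)) z - \<phi> (Suc k) z) \<le> M * (c * (2 * M * (1 / 2) ^ k)) * norm z ^ N"
    proof (rule improve[OF _ _ _ _ _ Suc.prems])
      fix z :: complex assume z: "z \<in> ball 0 r"
      have "norm ((\<nu> * z) *s vec_deriv (\<phi> (Suc (Suc k))) z - (\<nu> * z) *s vec_deriv (\<phi> (Suc k)) z)
          = norm (X (\<phi> (Suc k) z) - X (\<phi> k z))"
        by (simp only: T(2)[OF \<phi> z, folded \<phi>_Suc])
      also have "\<dots> \<le> c * norm (\<phi> (Suc k) z - \<phi> k z)" by (intro lip C_near \<phi> z)
      also have "\<dots> \<le> c * (2 * M * (1 / 2) ^ k * norm z ^ N)" by (intro mult_left_mono Suc.IH z c)
      finally show "norm ((\<nu> * z) *s vec_deriv (\<phi> (Suc (Suc k))) z - (\<nu> * z) *s vec_deriv (\<phi> (Suc k)) z)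
          \<le> c * (2 * M * (1 / 2) ^ k) * norm z ^ N" by simp
    qed (use \<phi>[of "Suc k"] \<phi>[of "Suc (Suc k)"] in \<open>auto simp: C_def\<close>)
    also have "\<dots> = (c * M) * (2 * M * (1 / 2) ^ k * norm z ^ N)" by simp
    also have "\<dots> \<le> 1 / 2 * (2 * M * (1 / 2) ^ k * norm z ^ N)"
      using cM \<open>0 < M\<close> by (intro mult_right_mono) auto
    finally show ?case by simp
  qed
  \<comment> \<open>The limit of the iterates as a telescoping series, dominated by a geometric
    one.\<close>
  define f where "f z = p z + (\<Sum>k. \<phi> (Suc k) z - \<phi> k z)" for z
  have "uniform_limit (ball 0 r) (\<lambda>n z. \<Sum>k<n. \<phi> (Suc k) z - \<phi> k z) (\<lambda>z. \<Sum>k. \<phi> (Suc k) z - \<phi> k z) sequentially"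
  proof (rule Weierstrass_m_test)
    show "summable (\<lambda>k. 2 * M * (1 / 2) ^ k * r ^ N)"
      by (intro summable_mult summable_mult2 summable_geometric) auto
    fix k and z :: complex assume z: "z \<in> ball 0 r"
    have "2 * M * (1 / 2) ^ k * norm z ^ N \<le> 2 * M * (1 / 2) ^ k * r ^ N"
      using z \<open>0 < M\<close> by (intro mult_left_mono power_mono) auto
    then show "norm (\<phi> (Suc k) z - \<phi> k z) \<le> 2 * M * (1 / 2) ^ k * r ^ N"
      using step[OF z, of k] by linarith
  qed
  then have "uniform_limit (ball 0 r) (\<lambda>n z. p z + (\<Sum>k<n. \<phi> (Suc k) z - \<phi> k z)) f sequentially"
    unfolding f_def by (intro uniform_limit_intros)
  moreover have "p z + (\<Sum>k<n. \<phi> (Suc k) z - \<phi> k z) = \<phi> n z" for n z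
    by (subst sum_lessThan_telescope) (simp add: \<phi>_def)
  ultimately have ulim: "uniform_limit (ball 0 r) \<phi> f sequentially" by simp
  \<comment> \<open>Locally uniform limits of holomorphic functions are holomorphic and the
    derivatives converge too, so the equation passes to the limit.\<close>
  have "\<exists>g'. \<forall>z\<in>ball 0 r. ((\<lambda>z. f z $ i) has_field_derivative g' z) (at z) \<and>
      (\<lambda>n. vec_deriv (\<phi> n) z $ i) \<longlonglongrightarrow> g' z" for i
  proof (rule has_complex_derivative_uniform_sequence[where f = "\<lambda>n z. \<phi> n z $ i"])
    show "((\<lambda>z. \<phi> n z $ i) has_field_derivative vec_deriv (\<phi> n) z $ i) (at z)" if "z \<in> ball 0 r" for n z
      using has_vec_deriv_vec_deriv[OF _ that, of "\<phi> n"] \<phi>[of n]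
      by (auto simp: C_def has_vec_deriv_component_iff)
    fix z :: complex assume "z \<in> ball 0 r"
    then obtain d where "0 < d" "cball z d \<subseteq> ball 0 r" by (meson open_ball open_contains_cball)
    then show "\<exists>d>0. cball z d \<subseteq> ball 0 r \<and>
        uniform_limit (cball z d) (\<lambda>n z. \<phi> n z $ i) (\<lambda>z. f z $ i) sequentially"
      using uniform_limit_on_subset[OF bounded_linear.uniform_limit[OF bounded_linear_vec_nth ulim]] by blast
  qed auto
  then obtain g' where g': "\<And>i z. z \<in> ball 0 r \<Longrightarrow> ((\<lambda>z. f z $ i) has_field_derivative g' i z) (at z)"
    "\<And>i z. z \<in> ball 0 r \<Longrightarrow> (\<lambda>n. vec_deriv (\<phi> n) z $ i) \<longlonglongrightarrow> g' i z"
    by metis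
  have deriv_f: "has_vec_deriv f (\<chi> i. g' i z) z" if "z \<in> ball 0 r" for z
    using g'(1)[OF that] by (simp add: has_vec_deriv_component_iff)
  then have hol_f: "vec_holomorphic_on f (ball 0 r)" by (rule vec_holomorphic_onI)
  have lim_deriv: "(\<lambda>n. vec_deriv (\<phi> n) z) \<longlonglongrightarrow> vec_deriv f z" if "z \<in> ball 0 r" for z
    using g'(2)[OF that] by (intro vec_tendstoI) (simp add: vec_deriv_eqI[OF deriv_f[OF that]])
  have lim: "(\<lambda>n. \<phi> n z) \<longlonglongrightarrow> f z" if "z \<in> ball 0 r" for z
    using tendsto_uniform_limitI[OF ulim that] .
  have f_p: "norm (f z - p z) \<le> 2 * M * norm z ^ N" if "z \<in> ball 0 r" for z
    by (rule Lim_bounded[of "\<lambda>n. norm (\<phi> n z - p z)" _ 0])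
      (use \<phi> that in \<open>auto simp: C_def intro!: tendsto_intros lim\<close>)
  have f_W: "f z \<in> W" if "z \<in> ball 0 r" for z
    using near[OF that f_p[OF that]] \<delta>(2) by blast
  have "f 0 = 0" using f_p[of 0] r p(2) N by (simp add: power_0_left)
  have ode: "(\<nu> * z) *s vec_deriv f z = X (f z)" if z: "z \<in> ball 0 r" for z
  proof (rule LIMSEQ_unique)
    show "(\<lambda>n. (\<nu> * z) *s vec_deriv (\<phi> (Suc n)) z) \<longlonglongrightarrow> (\<nu> * z) *s vec_deriv f z"
      by (intro bounded_linear.tendsto[OF bounded_linear_smult_right] LIMSEQ_Suc lim_deriv z)
    have "isCont X (f z)"
      using holomorphic_X f_W[OF z] unfolding holomorphic_map_on_def by (metis has_derivative_continuous)
    from isCont_tendsto_compose[OF this lim[OF z]]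
    show "(\<lambda>n. (\<nu> * z) *s vec_deriv (\<phi> (Suc n)) z) \<longlonglongrightarrow> X (f z)"
      by (simp add: \<phi>_Suc T(2)[OF \<phi> z])
  qed
  \<comment> \<open>\<open>f\<close> and \<open>p\<close> differ by at most
    \<open>2 * M * norm z ^ N\<close> with \<open>N\<close> at least 2, hence have the same velocity
    \<open>v\<close> at 0.\<close>
  have "has_vec_deriv (\<lambda>z. f z - p z) 0 0"
    unfolding has_vec_deriv_def has_derivative_at_alt
  proof (intro conjI bounded_linear_smult_left allI impI)
    fix e :: real assume "0 < e"
    define d where "d = min r (min 1 (e / (2 * M)))"
    have "norm (f y - p y) \<le> e * norm y" if y: "norm y < d" for y
    proof -
      have "norm y ^ N = norm y ^ n * norm y * norm y" by (simp add: N_def mult_ac)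
      also have "\<dots> \<le> 1 * norm y * norm y"
        using y by (intro mult_right_mono power_le_one) (auto simp: d_def)
      finally have "2 * M * norm y ^ N \<le> 2 * M * (norm y * norm y)" using \<open>0 < M\<close> by simp
      also have "\<dots> = 2 * M * norm y * norm y" by simp
      also have "2 * M * norm y \<le> e" using y \<open>0 < M\<close> by (simp add: d_def field_simps)
      finally show ?thesis using f_p[of y] y by (simp add: d_def mult_right_mono)
    qed
    moreover have "0 < d" using r \<open>0 < e\<close> \<open>0 < M\<close> by (simp add: d_def)
    ultimately show "\<exists>d>0. \<forall>y. norm (y - 0) < d \<longrightarrow>
        norm (f y - p y - (f 0 - p 0) - (y - 0) *s 0) \<le> e * norm (y - 0)"
      using \<open>f 0 = 0\<close> p(2) by auto
  qed
  moreover have "has_vec_deriv (\<lambda>z. f z - p z) (vec_deriv f 0 - vec_deriv p 0) 0"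
    using r by (intro has_vec_deriv_diff has_vec_deriv_vec_deriv[OF hol_f] has_vec_deriv_vec_deriv[OF hol_p]) auto
  ultimately have "vec_deriv f 0 = v"
    using p(3) by (auto dest!: vec_deriv_eqI)
  then show ?thesis using r hol_f \<open>f 0 = 0\<close> f_W ode by blast
qed

end

section \<open>Eigenvalues of the time one map\<close>

text \<open>These are one more vectors than the dimension. Dependence is a notion for sets, so
  coinciding iterates need a relation of their own, with coefficients 1 and -1.\<close>

lemma nontrivial_relation_of_iterates:
  fixes A :: "complex ^ 'n \<Rightarrow> complex ^ 'n"
  shows "\<exists>c. (\<exists>i\<le>CARD('n). c i \<noteq> 0) \<and> (\<Sum>i\<le>CARD('n). c i *s (A ^^ i) w) = 0"
proof (cases "inj_on (\<lambda>i. (A ^^ i) w) {..CARD('n)}")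
  case True
  let ?S = "(\<lambda>i. (A ^^ i) w) ` {..CARD('n)}"
  have "card ?S > CARD('n)" using True by (simp add: card_image)
  moreover have "card ?S \<le> CARD('n)" if "vec.independent ?S"
    using vec.independent_card_le_dim[OF subset_UNIV that] unfolding vec_dim_card .
  ultimately have "vec.dependent ?S" by (meson not_le)
  then obtain u where "\<exists>v\<in>?S. u v \<noteq> 0" "(\<Sum>v\<in>?S. u v *s v) = 0"
    using vec.dependent_finite[of ?S] by auto
  then show ?thesis
    by (intro exI[of _ "\<lambda>i. u ((A ^^ i) w)"]) (auto simp: sum.reindex[OF True])
next
  case False
  then obtain i j where ij: "i \<le> CARD('n)" "j \<le> CARD('n)" "i \<noteq> j" "(A ^^ i) w = (A ^^ j) w"
    by (auto simp: inj_on_def)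
  define c where "c k = (if k = i then 1 else if k = j then -1 else 0 :: complex)" for k
  have "(\<Sum>k\<le>CARD('n). c k *s (A ^^ k) w) = (\<Sum>k\<in>{i, j}. c k *s (A ^^ k) w)"
    using ij by (intro sum.mono_neutral_right) (auto simp: c_def)
  also have "\<dots> = 0" using ij by (simp add: c_def)
  finally show ?thesis using ij by (intro exI[of _ c]) (auto simp: c_def)
qed

text \<open>Take a polynomial p of least degree annihilating \<open>w\<close> under \<open>A\<close>
  and split off a root: p = (x - \<mu>) q. By minimality q(A) w is nonzero, and it is an eigenvector
  in \<open>V\<close>.\<close>

lemma eigenvector_in_invariant_subspace:
  fixes A :: "complex ^ 'n \<Rightarrow> complex ^ 'n"
  assumes linear: "Vector_Spaces.linear (*s) (*s) A" and V: "vec.subspace V"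
    and invariant: "\<And>x. x \<in> V \<Longrightarrow> A x \<in> V" and w: "w \<in> V" "w \<noteq> 0"
  shows "\<exists>\<mu>. \<exists>v\<in>V. v \<noteq> 0 \<and> A v = \<mu> *s v"
proof -
  interpret A: Vector_Spaces.linear "(*s)" "(*s)" A by fact
  \<comment> \<open>This is p(A) w once \<open>n\<close> reaches the degree of \<open>p\<close>. The
    separate bound makes it linear in \<open>p\<close>.\<close>
  define S where "S n p = (\<Sum>i\<le>n. coeff p i *s (A ^^ i) w)" for n and p :: "complex poly"
  have iter_V: "(A ^^ i) w \<in> V" for i by (induction i) (auto intro: invariant w)
  have S_V: "S n p \<in> V" for n p
    unfolding S_def by (intro vec.subspace_sum vec.subspace_scale V iter_V)
  have S_extend: "S m p = S (degree p) p" if "degree p \<le> m" for m p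
    unfolding S_def using that by (intro sum.mono_neutral_right) (auto simp: coeff_eq_0)
  have S_pCons: "S (Suc n) (pCons 0 q) = A (S n q)" for n q
    unfolding S_def by (simp add: sum.atMost_Suc_shift A.sum A.scale del: sum.atMost_Suc)
  have S_lin: "S n (p - smult \<mu> q) = S n p - \<mu> *s S n q" for n p \<mu> q
    unfolding S_def by (simp add: vec.scale_sum_right sum_subtractf[symmetric] vec.scale_left_diff_distrib)
  define good where "good p \<longleftrightarrow> p \<noteq> 0 \<and> S (degree p) p = 0" for p
  have "\<exists>p. good p"
  proof -
    obtain c where c: "\<exists>i\<le>CARD('n). c i \<noteq> 0" "(\<Sum>i\<le>CARD('n). c i *s (A ^^ i) w) = 0"
      using nontrivial_relation_of_iterates by blast
    define p where "p = (\<Sum>i\<le>CARD('n). monom (c i) i)"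
    have coeff: "coeff p i = (if i \<le> CARD('n) then c i else 0)" for i
      by (auto simp: p_def coeff_sum sum.delta)
    have "degree p \<le> CARD('n)" by (rule degree_le) (simp add: coeff)
    then have "S (degree p) p = S CARD('n) p" by (rule S_extend[symmetric])
    also have "\<dots> = 0" using c(2) by (simp add: S_def coeff)
    finally have "S (degree p) p = 0" .
    moreover have "p \<noteq> 0" using c(1) coeff by (metis coeff_0)
    ultimately show ?thesis by (auto simp: good_def)
  qed
  then obtain p where p: "good p" and least: "\<And>q. good q \<Longrightarrow> degree p \<le> degree q"
    using ex_has_least_nat[of good _ degree] by blast
  have "degree p \<noteq> 0"
  proof
    assume "degree p = 0"
    then have "S (degree p) p = lead_coeff p *s w" by (simp add: S_def)
    moreover have "lead_coeff p \<noteq> 0" "S (degree p) p = 0" using p by (simp_all add: good_def)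
    ultimately show False using w(2) vec.scale_eq_0_iff by metis
  qed
  then have "\<not> constant (poly p)" by (simp add: constant_degree)
  then obtain \<mu> where "poly p \<mu> = 0" using fundamental_theorem_of_algebra by blast
  then obtain q where q: "p = [:- \<mu>, 1:] * q" by (metis dvdE poly_eq_0_iff_dvd)
  have "q \<noteq> 0" using q p by (auto simp: good_def)
  then have deg: "degree p = Suc (degree q)" unfolding q by (subst degree_mult_eq) auto
  have "S (degree q) q \<noteq> 0" using least[of q] deg \<open>q \<noteq> 0\<close> by (auto simp: good_def)
  moreover have "A (S (degree q) q) = \<mu> *s S (degree q) q"
  proof -
    have "p = pCons 0 q - smult \<mu> q" unfolding q by simp
    then have "S (Suc (degree q)) p = A (S (degree q) q) - \<mu> *s S (degree q) q"
      using S_extend[of q "Suc (degree q)"] by (simp only: S_lin S_pCons)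
    then show ?thesis using p deg by (simp add: good_def)
  qed
  ultimately show ?thesis using S_V by blast
qed

lemma has_vec_deriv_chain:
  assumes "has_vec_deriv f v (g t)" "(g has_vector_derivative g') (at t within T)"
  shows "((\<lambda>t. f (g t)) has_vector_derivative g' *s v) (at t within T)"
proof -
  have "((\<lambda>t. f (g t)) has_derivative (\<lambda>h. (h *\<^sub>R g') *s v)) (at t within T)"
    using has_derivative_compose[of g "\<lambda>h. h *\<^sub>R g'" t T f "\<lambda>h. h *s v"] assms
    by (simp add: has_vec_deriv_def has_vector_derivative_def)
  moreover have "(h *\<^sub>R g') *s v = h *\<^sub>R (g' *s v)" for h
    by (simp add: vec_eq_iff)
  ultimately show ?thesis by (simp add: has_vector_derivative_def)
qed

section \<open>The exponential of the linear part and the derivative of the time one map\<close>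

context singular_vector_field
begin

text \<open>The exponential of \<open>t D\<close> applied to \<open>w\<close>, written as a
  vector-valued series.\<close>

definition linear_flow :: "complex \<Rightarrow> complex ^ 'n \<Rightarrow> complex ^ 'n"
  where "linear_flow t w = (\<Sum>k. (t ^ k / fact k) *s (D ^^ k) w)"

lemma norm_iterate_le: "norm ((D ^^ k) w) \<le> onorm D ^ k * norm w"
proof (induction k)
  case (Suc k)
  have "norm ((D ^^ Suc k) w) \<le> onorm D * norm ((D ^^ k) w)"
    using onorm[OF bounded_linear_D] by simp
  also have "\<dots> \<le> onorm D * (onorm D ^ k * norm w)"
    using Suc by (intro mult_left_mono onorm_pos_le bounded_linear_D)
  finally show ?case by simp
qed simp

lemma linear_flow_sums: "(\<lambda>k. (t ^ k / fact k) *s (D ^^ k) w) sums linear_flow t w"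
  unfolding linear_flow_def
proof (rule summable_sums, rule summable_comparison_test'[where N = 0])
  show "summable (\<lambda>k. ((norm t * onorm D) ^ k /\<^sub>R fact k) * norm w)"
    by (rule summable_mult2[OF summable_exp_generic])
  fix k
  have "norm ((t ^ k / fact k) *s (D ^^ k) w) = norm t ^ k / fact k * norm ((D ^^ k) w)"
    by (simp add: norm_smult_vec norm_divide norm_power)
  also have "\<dots> \<le> norm t ^ k / fact k * (onorm D ^ k * norm w)"
    by (intro mult_left_mono norm_iterate_le) simp
  also have "\<dots> = ((norm t * onorm D) ^ k /\<^sub>R fact k) * norm w"
    by (simp add: power_mult_distrib divide_inverse mult_ac)
  finally show "norm ((t ^ k / fact k) *s (D ^^ k) w) \<le> ((norm t * onorm D) ^ k /\<^sub>R fact k) * norm w" .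
qed

lemma linear_flow_commute: "D (linear_flow t w) = linear_flow t (D w)"
proof (rule sums_unique2)
  show "(\<lambda>k. (t ^ k / fact k) *s D ((D ^^ k) w)) sums D (linear_flow t w)"
    using bounded_linear.sums[OF bounded_linear_D linear_flow_sums] by (simp add: D.scale)
  show "(\<lambda>k. (t ^ k / fact k) *s D ((D ^^ k) w)) sums linear_flow t (D w)"
    using linear_flow_sums[of t "D w"] by (simp add: funpow_swap1)
qed

lemma linear_flow_zero: "linear_flow 0 w = w"
proof (rule sums_unique2[OF linear_flow_sums])
  show "(\<lambda>k. (0 ^ k / fact k) *s (D ^^ k) w) sums w"
    using sums_single[of 0 "\<lambda>_. w"] by (rule sums_cong[THEN iffD1, rotated]) (auto simp: power_0_left)
qed

lemma linear_flow_eigenvector: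
  assumes "D v = \<mu> *s v"
  shows "linear_flow t v = exp (t * \<mu>) *s v"
proof (rule sums_unique2[OF linear_flow_sums])
  have "(D ^^ k) v = \<mu> ^ k *s v" for k
    by (induction k) (auto simp: D.scale assms mult.commute)
  then have "(t ^ k / fact k) *s (D ^^ k) v = ((t * \<mu>) ^ k /\<^sub>R fact k) *s v" for k
    by (simp add: power_mult_distrib scaleR_conv_of_real divide_inverse mult_ac)
  then show "(\<lambda>k. (t ^ k / fact k) *s (D ^^ k) v) sums (exp (t * \<mu>) *s v)"
    using bounded_linear.sums[OF bounded_linear_smult_left exp_converges[of "t * \<mu>"], of v] by simp
qed

lemma has_vec_deriv_linear_flow: "has_vec_deriv (\<lambda>t. linear_flow t w) (D (linear_flow t w)) t"
  unfolding has_vec_deriv_component_iff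
proof
  fix i
  define c where "c k = (D ^^ k) w $ i / fact k" for k
  have sums: "(\<lambda>k. c k * t ^ k) sums (linear_flow t w $ i)" for t
    using bounded_linear.sums[OF bounded_linear_vec_nth[of i] linear_flow_sums[of t w]]
    by (simp add: c_def mult.commute)
  have "((\<lambda>t. \<Sum>k. c k * t ^ k) has_field_derivative (\<Sum>k. diffs c k * t ^ k)) (at t)"
    using sums by (intro termdiffs_strong_converges_everywhere) (rule sums_summable)
  moreover have "(\<Sum>k. c k * t ^ k) = linear_flow t w $ i" for t
    using sums[of t] by (rule sums_unique[symmetric])
  moreover have "(\<Sum>k. diffs c k * t ^ k) = D (linear_flow t w) $ i"
  proof (rule sums_unique[symmetric])
    have "diffs c k * t ^ k = ((t ^ k / fact k) *s (D ^^ k) (D w)) $ i" for k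
      by (simp add: diffs_def c_def funpow_swap1 field_simps del: of_nat_Suc)
    then show "(\<lambda>k. diffs c k * t ^ k) sums (D (linear_flow t w) $ i)"
      using bounded_linear.sums[OF bounded_linear_vec_nth[of i] linear_flow_sums[of t "D w"]]
      by (simp add: linear_flow_commute)
  qed
  ultimately show "((\<lambda>t. linear_flow t w $ i) has_field_derivative D (linear_flow t w) $ i) (at t)"
    by simp
qed

lemma linear_flow_real_vector_derivative:
  "((\<lambda>t. linear_flow (of_real t) w) has_vector_derivative D (linear_flow (of_real t) w)) (at t within T)"
proof -
  have "((\<lambda>t. complex_of_real t) has_vector_derivative 1) (at t within T)"
    using bounded_linear.has_vector_derivative[OF bounded_linear_of_real has_vector_derivative_id] by simp
  from has_vec_deriv_chain[OF has_vec_deriv_linear_flow this] show ?thesis by simp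
qed

text \<open>The integral curve from \<open>s w\<close> and s times the linear flow of
  \<open>w\<close> differ by \<open>d\<close> with d' = D d plus the nonlinear remainder along the
  curve. Gronwall bounds \<open>d 1\<close> by a small multiple of s, so F(s w)/s is close to the
  linear flow at time 1.\<close>

theorem time_one_map_derivative:
  assumes germ: "time_one_map_germ W X F" and F: "(F has_derivative L) (at 0)" "F 0 = 0"
  shows "L w = linear_flow 1 w"
proof (rule ccontr)
  assume "L w \<noteq> linear_flow 1 w"
  define x where "x = norm (L w - linear_flow 1 w)"
  have "0 < x" using \<open>L w \<noteq> _\<close> by (simp add: x_def)
  have "continuous_on {0..1} (\<lambda>t. linear_flow (of_real t) w)"
    by (intro continuous_at_imp_continuous_on ballI
        has_vector_derivative_continuous[OF linear_flow_real_vector_derivative])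
  then have "bounded ((\<lambda>t. linear_flow (of_real t) w) ` {0..1})"
    by (intro compact_imp_bounded compact_continuous_image) auto
  then obtain M where "0 < M" and M: "\<And>t. t \<in> {0..1} \<Longrightarrow> norm (linear_flow (of_real t) w) \<le> M"
    by (auto simp: bounded_pos)
  define a where "a = onorm D"
  have "0 \<le> a" unfolding a_def by (intro onorm_pos_le bounded_linear_D)
  \<comment> \<open>\<open>\<epsilon> * K\<close> is the total relative error: \<open>norm w\<close>
    from differentiating \<open>F\<close>, the other term from Gronwall. In its exponent
    \<open>a + \<epsilon> + 1\<close> is at most \<open>a + 2\<close>.\<close>
  define K where "K = norm w + M * exp (a + 2)"
  have "0 < K" using \<open>0 < M\<close> by (simp add: K_def add_nonneg_pos)
  define \<epsilon> where "\<epsilon> = min 1 (x / (2 * K))"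
  have \<epsilon>: "0 < \<epsilon>" "\<epsilon> \<le> 1" using \<open>0 < x\<close> \<open>0 < K\<close> by (auto simp: \<epsilon>_def)
  have "\<epsilon> * K \<le> x / (2 * K) * K" using \<open>0 < K\<close> by (intro mult_right_mono) (auto simp: \<epsilon>_def)
  then have "\<epsilon> * K < x" using \<open>0 < K\<close> \<open>0 < x\<close> by simp
  obtain \<delta> where \<delta>: "0 < \<delta>" and lip: "\<And>x y. x \<in> ball 0 \<delta> \<Longrightarrow> y \<in> ball 0 \<delta> \<Longrightarrow>
      norm ((X x - D x) - (X y - D y)) \<le> \<epsilon> * norm (x - y)"
    using remainder_lipschitz[OF \<epsilon>(1)] by blast
  have rem: "norm (X x - D x) \<le> \<epsilon> * norm x" if "norm x < \<delta>" for x
    using lip[of x 0] that \<delta> by (simp add: X_zero D.zero)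
  obtain \<eta> where "0 < \<eta>" and \<eta>: "\<And>p. norm p < \<eta> \<Longrightarrow>
      \<exists>\<gamma>. integral_curve W X \<gamma> {0..1} \<and> \<gamma> 0 = p \<and> \<gamma> 1 = F p"
    using germ unfolding time_one_map_germ_def eventually_nhds_metric by auto
  obtain \<theta> where "0 < \<theta>" and \<theta>: "\<And>y. norm y < \<theta> \<Longrightarrow> norm (F y - L y) \<le> \<epsilon> * norm y"
    using F \<epsilon>(1) unfolding has_derivative_at_alt by force
  define C where "C = min (min \<eta> \<theta>) (\<delta> / 2)"
  have "0 < C" using \<open>0 < \<eta>\<close> \<open>0 < \<theta>\<close> \<open>0 < \<delta>\<close> by (simp add: C_def)
  \<comment> \<open>Makes \<open>s * norm w\<close>, \<open>s * M\<close> and the Gronwall barrier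
    all smaller than \<open>C\<close>.\<close>
  define s where "s = C / 2 / (K + M)"
  have "0 < s" using \<open>0 < C\<close> \<open>0 < K\<close> \<open>0 < M\<close> by (simp add: s_def)
  have "K + M \<noteq> 0" using \<open>0 < K\<close> \<open>0 < M\<close> by simp
  then have "s * (K + M) = C / 2" by (metis eq_divide_eq s_def)
  then have "s * norm w + s * (M * exp (a + 2)) + s * M < C"
    using \<open>0 < C\<close> by (simp add: K_def distrib_left)
  moreover have "0 \<le> s * norm w" "0 < s * (M * exp (a + 2))" "0 < s * M"
    using \<open>0 < s\<close> \<open>0 < M\<close> by auto
  ultimately have s: "s * norm w < C" "s * (M * exp (a + 2)) < C" "s * M < C" by linarith+
  have "norm (s *\<^sub>R w) < \<eta>" "norm (s *\<^sub>R w) < \<theta>" using s \<open>0 < s\<close> by (auto simp: C_def)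
  obtain \<gamma> where \<gamma>: "integral_curve W X \<gamma> {0..1}" "\<gamma> 0 = s *\<^sub>R w" "\<gamma> 1 = F (s *\<^sub>R w)"
    using \<eta>[OF \<open>norm (s *\<^sub>R w) < \<eta>\<close>] by blast
  define d where "d t = \<gamma> t - s *\<^sub>R linear_flow (of_real t) w" for t
  define d' where "d' t = X (\<gamma> t) - s *\<^sub>R D (linear_flow (of_real t) w)" for t
  have "norm (d 1) < (\<epsilon> * s * M) * exp ((a + \<epsilon> + 1) * 1)"
  proof (rule norm_lt_exponential_of_deriv_bound[where d' = d' and \<delta> = "\<delta> / 2"])
    show "(d has_vector_derivative d' t) (at t within {0..1})" if "t \<in> {0..1}" for t
      unfolding d_def d'_def using \<gamma>(1) that
      by (intro has_vector_derivative_diff linear_flow_real_vector_derivative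
          bounded_linear.has_vector_derivative[OF bounded_linear_scaleR_right])
        (auto simp: integral_curve_def)
    show "d 0 = 0" by (simp add: d_def \<gamma> linear_flow_zero)
    have "\<epsilon> * (s * (M * exp (a + \<epsilon> + 1))) \<le> 1 * (s * (M * exp (a + 2)))"
      using \<epsilon> \<open>0 < s\<close> \<open>0 < M\<close> by (intro mult_mono) auto
    then show "\<epsilon> * s * M * exp (a + \<epsilon> + 1) \<le> \<delta> / 2" using s(2) by (simp add: C_def mult.assoc)
    fix t :: real assume t: "t \<in> {0..1}" and "norm (d t) \<le> \<delta> / 2"
    have le: "norm (s *\<^sub>R linear_flow (of_real t) w) \<le> s * M" using M[OF t] \<open>0 < s\<close> by simp
    have \<gamma>_eq: "\<gamma> t = d t + s *\<^sub>R linear_flow (of_real t) w" by (simp add: d_def)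
    have n: "norm (\<gamma> t) \<le> norm (d t) + s * M"
      unfolding \<gamma>_eq using le norm_triangle_ineq[of "d t" "s *\<^sub>R linear_flow (of_real t) w"] by linarith
    then have "norm (\<gamma> t) < \<delta>" using s(3) \<open>norm (d t) \<le> \<delta> / 2\<close> by (simp add: C_def)
    have "d' t = D (d t) + (X (\<gamma> t) - D (\<gamma> t))"
      unfolding d'_def \<gamma>_eq by (simp add: D.add D.scale scaleR_eq_smult)
    also have "norm \<dots> \<le> a * norm (d t) + \<epsilon> * norm (\<gamma> t)"
      unfolding a_def by (intro norm_triangle_mono onorm bounded_linear_D rem \<open>norm (\<gamma> t) < \<delta>\<close>)
    also have "\<dots> \<le> a * norm (d t) + \<epsilon> * (norm (d t) + s * M)"
      using n \<epsilon> by (intro add_left_mono mult_left_mono) auto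
    finally show "norm (d' t) \<le> (a + \<epsilon>) * norm (d t) + \<epsilon> * s * M" by (simp add: algebra_simps)
  qed (use \<epsilon> \<open>0 < s\<close> \<open>0 < M\<close> \<open>0 \<le> a\<close> in auto)
  also have "\<dots> \<le> (\<epsilon> * s * M) * exp (a + 2)"
    using \<epsilon> \<open>0 < s\<close> \<open>0 < M\<close> by (intro mult_left_mono) auto
  finally have 1: "norm (F (s *\<^sub>R w) - s *\<^sub>R linear_flow 1 w) \<le> \<epsilon> * s * M * exp (a + 2)"
    by (simp add: d_def \<gamma>)
  have "L (s *\<^sub>R w) = s *\<^sub>R L w"
    using has_derivative_bounded_linear[OF F(1)] by (simp add: bounded_linear.linear linear_cmul)
  then have "s *\<^sub>R (L w - linear_flow 1 w) =
      (F (s *\<^sub>R w) - s *\<^sub>R linear_flow 1 w) - (F (s *\<^sub>R w) - L (s *\<^sub>R w))"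
    by (simp add: scaleR_diff_right)
  also have "norm \<dots> \<le> \<epsilon> * s * M * exp (a + 2) + \<epsilon> * norm (s *\<^sub>R w)"
    by (intro norm_triangle_ineq4[THEN order_trans] add_mono 1 \<theta>) fact
  also have "\<dots> = s * (\<epsilon> * K)" using \<open>0 < s\<close> by (simp add: K_def algebra_simps)
  finally have "s * x \<le> s * (\<epsilon> * K)" using \<open>0 < s\<close> by (simp add: x_def)
  then show False using \<open>0 < s\<close> \<open>\<epsilon> * K < x\<close> by simp
qed

end

section \<open>Infinite orbits\<close>

text \<open>Stated for arbitrary \<open>H\<close> and \<open>\<kappa>\<close> to serve both the map
  with exp(\<nu>) and its inverse with exp(-\<nu>). The orbit never leaves the disc, also when
  \<open>norm \<kappa> = 1\<close>, and two equal points would make a positive power of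
  \<open>\<kappa>\<close> equal to 1.\<close>

lemma infinite_positive_orbit:
  fixes \<kappa> z :: complex
  assumes inj: "inj_on f (ball 0 \<rho>)" and A: "f ` ball 0 \<rho> \<subseteq> A"
    and step: "\<And>z. z \<in> ball 0 \<rho> \<Longrightarrow> H (f z) = f (\<kappa> * z)"
    and \<kappa>: "norm \<kappa> \<le> 1" "\<kappa> \<noteq> 0" "\<And>k. 0 < k \<Longrightarrow> \<kappa> ^ k \<noteq> 1"
    and z: "z \<in> ball 0 \<rho>" "z \<noteq> 0"
  shows "infinite (positive_orbit H A (f z))"
proof -
  have ball: "\<kappa> ^ j * z \<in> ball 0 \<rho>" for j
  proof -
    have "norm (\<kappa> ^ j * z) \<le> norm z"
      using \<kappa>(1) by (simp add: norm_mult norm_power power_le_one mult_left_le_one_le)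
    then show ?thesis using z by simp
  qed
  have orbit: "(H ^^ j) (f z) = f (\<kappa> ^ j * z)" for j
    by (induction j) (simp_all add: step[OF ball] mult.assoc)
  have le: "i = j" if "f (\<kappa> ^ i * z) = f (\<kappa> ^ j * z)" "i \<le> j" for i j
  proof (rule ccontr)
    assume "i \<noteq> j"
    have "\<kappa> ^ i * z = \<kappa> ^ j * z" using that(1) ball by (meson inj inj_onD)
    then have "\<kappa> ^ i = \<kappa> ^ j" using z by simp
    also have "\<kappa> ^ j = \<kappa> ^ i * \<kappa> ^ (j - i)"
      using \<open>i \<le> j\<close> by (simp add: power_add[symmetric])
    finally have "\<kappa> ^ (j - i) = 1" using \<kappa>(2) by simp
    then show False using \<kappa>(3)[of "j - i"] \<open>i \<noteq> j\<close> \<open>i \<le> j\<close> by simp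
  qed
  have "inj (\<lambda>j. f (\<kappa> ^ j * z))"
    by (rule injI) (metis le nat_le_linear)
  then have "infinite (range (\<lambda>j. f (\<kappa> ^ j * z)))"
    using finite_imageD by blast
  moreover have "range (\<lambda>j. f (\<kappa> ^ j * z)) \<subseteq> positive_orbit H A (f z)"
  proof
    fix y assume "y \<in> range (\<lambda>j. f (\<kappa> ^ j * z))"
    then obtain j where "y = (H ^^ j) (f z)" by (auto simp: orbit)
    moreover have "(H ^^ k) (f z) \<in> A" for k using A ball by (auto simp: orbit)
    ultimately show "y \<in> positive_orbit H A (f z)" by (auto simp: positive_orbit_def)
  qed
  ultimately show ?thesis using finite_subset by blast
qed

lemma vec_holomorphic_locally_injective:
  assumes "vec_holomorphic_on f (ball 0 r)" "0 < r" "vec_deriv f 0 \<noteq> 0"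
  shows "\<exists>\<rho>>0. \<rho> \<le> r \<and> inj_on f (ball 0 \<rho>)"
proof -
  obtain i where i: "vec_deriv f 0 $ i \<noteq> 0" using assms(3) by (auto simp: vec_eq_iff)
  have "(\<lambda>z. f z $ i) holomorphic_on ball 0 r"
    using assms(1) by (auto simp: vec_holomorphic_on_component_iff)
  then obtain \<rho> where \<rho>: "0 < \<rho>" "ball 0 \<rho> \<subseteq> ball (0 :: complex) r" "inj_on (\<lambda>z. f z $ i) (ball 0 \<rho>)"
    by (rule has_complex_derivative_locally_injective) (use i assms(2) in \<open>auto simp: vec_deriv_def\<close>)
  have "inj_on f (ball 0 \<rho>)"
    by (rule inj_on_imageI2[of "\<lambda>v. v $ i"]) (use \<rho>(3) in \<open>simp add: o_def\<close>)
  moreover have "\<rho> \<le> r" using \<rho> assms(2) by (simp add: ball_subset_ball_iff)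
  ultimately show ?thesis using \<rho>(1) by blast
qed

section \<open>Action on the separatrix and comparison of the spectra\<close>

context singular_vector_field
begin

text \<open>By the Briot-Bouquet equation and the chain rule, f(exp(t \<nu>) z) is an integral curve
  in t; Gronwall identifies it at time 1 with the one defining \<open>F\<close>.\<close>

lemma time_one_map_on_separatrix:
  assumes germ: "time_one_map_germ W X F" and r: "0 < r"
    and f: "vec_holomorphic_on f (ball 0 r)" "f 0 = 0"
    and ode: "\<And>z. z \<in> ball 0 r \<Longrightarrow> (\<nu> * z) *s vec_deriv f z = X (f z)"
  shows "\<exists>\<rho>>0. \<forall>z\<in>ball 0 \<rho>. F (f z) = f (exp \<nu> * z)"
proof -
  obtain c \<delta> where c: "0 \<le> c" and \<delta>: "0 < \<delta>"
    and lip: "\<And>x y. x \<in> ball 0 \<delta> \<Longrightarrow> y \<in> ball 0 \<delta> \<Longrightarrow> norm (X x - X y) \<le> c * norm (x - y)"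
    using X_lipschitz by blast
  obtain \<eta> where \<eta>: "0 < \<eta>" "\<And>p. norm p < \<eta> \<Longrightarrow>
      \<exists>\<gamma>. integral_curve W X \<gamma> {0..1} \<and> \<gamma> 0 = p \<and> \<gamma> 1 = F p"
    using germ unfolding time_one_map_germ_def eventually_nhds_metric by auto
  have "isCont f 0" using vec_holomorphic_on_imp_continuous[OF f(1)] r by simp
  then obtain r1 where r1: "0 < r1" "r1 \<le> r" "f ` ball 0 r1 \<subseteq> ball 0 (min (\<delta> / 2) \<eta>)"
    using ball_mapped_into_open[of f "ball 0 (min (\<delta> / 2) \<eta>)" r] f(2) \<delta> \<eta>(1) r by auto
  \<comment> \<open>Keeps exp(t \<nu>) z in the disc of radius \<open>r1\<close> for all times up to
    1.\<close>
  define \<rho> where "\<rho> = r1 / exp (norm \<nu>)"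
  have "F (f z) = f (exp \<nu> * z)" if z: "z \<in> ball 0 \<rho>" for z
  proof (rule ccontr)
    assume ne: "F (f z) \<noteq> f (exp \<nu> * z)"
    have traj: "exp (t *\<^sub>R \<nu>) * z \<in> ball 0 r1" if t: "t \<in> {0..1}" for t
    proof -
      have "norm (exp (t *\<^sub>R \<nu>)) \<le> exp (norm (t *\<^sub>R \<nu>))" by (rule norm_exp)
      also have "\<dots> \<le> exp (norm \<nu>)" using t by (simp add: mult_left_le_one_le)
      finally have "norm (exp (t *\<^sub>R \<nu>) * z) \<le> exp (norm \<nu>) * norm z"
        by (simp add: norm_mult mult_right_mono)
      also have "\<dots> < r1" using z by (simp add: \<rho>_def pos_less_divide_eq mult.commute)
      finally show ?thesis by simp
    qed
    have small: "norm (f (exp (t *\<^sub>R \<nu>) * z)) < \<delta> / 2" "norm (f (exp (t *\<^sub>R \<nu>) * z)) < \<eta>"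
      if "t \<in> {0..1}" for t
      using r1(3) traj[OF that] by (auto simp: image_subset_iff)
    have "norm (f z) < \<eta>" using small(2)[of 0] by simp
    then obtain \<gamma> where \<gamma>: "integral_curve W X \<gamma> {0..1}" "\<gamma> 0 = f z" "\<gamma> 1 = F (f z)"
      using \<eta>(2) by blast
    define d where "d t = \<gamma> t - f (exp (t *\<^sub>R \<nu>) * z)" for t
    define x where "x = norm (d 1)"
    have "0 < x" using ne by (simp add: x_def d_def \<gamma>)
    \<comment> \<open>The difference satisfies the growth bound without an additive term, so
      \<open>b\<close> may be any positive number. This one makes the barrier at time 1 at most
      \<open>x\<close>, the distance assumed positive.\<close>
    define b where "b = min x (\<delta> / 2) / exp (c + 1)"
    have b: "0 < b" "b * exp (c + 1) = min x (\<delta> / 2)"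
      using \<open>0 < x\<close> \<delta> by (simp_all add: b_def)
    have "norm (d 1) < b * exp ((c + 1) * 1)"
    proof (rule norm_lt_exponential_of_deriv_bound[where \<delta> = "\<delta> / 2" and
          d' = "\<lambda>t. X (\<gamma> t) - X (f (exp (t *\<^sub>R \<nu>) * z))"])
      show "(d has_vector_derivative X (\<gamma> t) - X (f (exp (t *\<^sub>R \<nu>) * z))) (at t within {0..1})"
        if t: "t \<in> {0..1}" for t
        unfolding d_def
      proof (rule has_vector_derivative_diff)
        show "(\<gamma> has_vector_derivative X (\<gamma> t)) (at t within {0..1})"
          using \<gamma>(1) t by (auto simp: integral_curve_def)
        have in_r: "exp (t *\<^sub>R \<nu>) * z \<in> ball 0 r" using traj[OF t] r1(2) by auto
        have "((\<lambda>t. exp (t *\<^sub>R \<nu>) * z) has_vector_derivative exp (t *\<^sub>R \<nu>) * \<nu> * z) (at t within {0..1})"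
          by (intro has_vector_derivative_mult_left exp_scaleR_has_vector_derivative_right)
        from has_vec_deriv_chain[OF has_vec_deriv_vec_deriv[OF f(1) in_r] this]
        show "((\<lambda>t. f (exp (t *\<^sub>R \<nu>) * z)) has_vector_derivative X (f (exp (t *\<^sub>R \<nu>) * z))) (at t within {0..1})"
          using ode[OF in_r] by (simp add: mult_ac)
      qed
      fix t :: real assume t: "t \<in> {0..1}" and d: "norm (d t) \<le> \<delta> / 2"
      have "norm (\<gamma> t) \<le> norm (d t) + norm (f (exp (t *\<^sub>R \<nu>) * z))"
        using norm_triangle_ineq[of "d t" "f (exp (t *\<^sub>R \<nu>) * z)"] by (simp add: d_def)
      then have "norm (\<gamma> t) < \<delta>" using d small(1)[OF t] by linarith
      then have "norm (X (\<gamma> t) - X (f (exp (t *\<^sub>R \<nu>) * z))) \<le> c * norm (d t)"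
        unfolding d_def using small(1)[OF t] \<delta> by (intro lip) auto
      then show "norm (X (\<gamma> t) - X (f (exp (t *\<^sub>R \<nu>) * z))) \<le> c * norm (d t) + b"
        using b(1) by linarith
    qed (use b c in \<open>auto simp: d_def \<gamma>\<close>)
    then show False using b(2) by (simp add: x_def)
  qed
  moreover have "0 < \<rho>" using r1(1) by (simp add: \<rho>_def)
  ultimately show ?thesis by blast
qed

text \<open>\<open>L\<close> is the exponential of \<open>D\<close> and commutes with it, so
  \<open>D\<close> preserves the eigenspace of \<open>L\<close> for \<open>\<xi>\<close> and has an
  eigenvector there.\<close>

lemma eigenvalue_of_time_one_map:
  assumes germ: "time_one_map_germ W X F" and F: "(F has_derivative L) (at 0)" "F 0 = 0"
    and linear_L: "Vector_Spaces.linear (*s) (*s) L" and "\<xi> \<in> Spec L"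
  shows "\<exists>\<mu>\<in>Spec D. exp \<mu> = \<xi>"
proof -
  interpret L: Vector_Spaces.linear "(*s)" "(*s)" L by fact
  have L: "L x = linear_flow 1 x" for x by (rule time_one_map_derivative[OF germ F])
  define V where "V = {x. L x = \<xi> *s x}"
  have V: "vec.subspace V"
    by (auto simp: vec.subspace_def V_def L.zero L.add L.scale vec.scale_right_distrib vec.scale_left_commute)
  have "D x \<in> V" if "x \<in> V" for x
  proof -
    have "L (D x) = D (L x)" by (simp add: L linear_flow_commute)
    then show ?thesis using that by (simp add: V_def D.scale)
  qed
  moreover obtain w where "w \<in> V" "w \<noteq> 0" using \<open>\<xi> \<in> Spec L\<close> by (auto simp: Spec_def V_def)
  ultimately obtain \<mu> v where v: "v \<in> V" "v \<noteq> 0" "D v = \<mu> *s v"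
    using eigenvector_in_invariant_subspace[OF linear_D V] by blast
  have "L v = \<xi> *s v" using v(1) by (simp only: V_def mem_Collect_eq)
  moreover have "L v = exp \<mu> *s v"
    using linear_flow_eigenvector[OF v(3), of 1] by (simp only: L mult_1)
  ultimately have "\<xi> *s v = exp \<mu> *s v" by (rule trans[OF sym])
  then have "exp \<mu> = \<xi>" using v(2) vec.scale_right_imp_eq by metis
  then show ?thesis using v by (auto simp: Spec_def)
qed

lemma norm_eigenvalue_le: "\<mu> \<in> Spec D \<Longrightarrow> norm \<mu> \<le> onorm D"
proof -
  assume "\<mu> \<in> Spec D"
  then obtain v where v: "v \<noteq> 0" "D v = \<mu> *s v" by (auto simp: Spec_def)
  have "norm \<mu> * norm v \<le> onorm D * norm v"
    using onorm[OF bounded_linear_D, of v] by (simp add: v(2) norm_smult_vec)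
  then show ?thesis using v(1) by simp
qed

text \<open>Eigenvalues are bounded by \<open>onorm D\<close> and \<open>\<mu>\<close> is nonzero,
  so only finitely many multiples qualify and a largest one exists.\<close>

lemma nonresonant_multiple:
  assumes "\<mu> \<in> Spec D" "\<mu> \<noteq> 0"
  shows "\<exists>m>0. of_nat m * \<mu> \<in> Spec D \<and> (\<forall>k\<ge>2. of_nat k * (of_nat m * \<mu>) \<notin> Spec D)"
proof -
  define S where "S = {m. 0 < m \<and> of_nat m * \<mu> \<in> Spec D}"
  obtain N where N: "onorm D / norm \<mu> \<le> of_nat N" using real_arch_simple by blast
  have "m \<le> N" if "m \<in> S" for m
  proof -
    have "of_nat m * norm \<mu> \<le> onorm D"
      using norm_eigenvalue_le[of "of_nat m * \<mu>"] that by (simp add: S_def norm_mult)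
    then have "of_nat m \<le> onorm D / norm \<mu>" using assms(2) by (simp add: pos_le_divide_eq)
    with N have "real m \<le> real N" by linarith
    then show ?thesis by simp
  qed
  then have "finite S" by (meson finite_nat_set_iff_bounded_le)
  moreover have "1 \<in> S" using assms by (simp add: S_def)
  ultimately have Max: "Max S \<in> S" "\<And>m. m \<in> S \<Longrightarrow> m \<le> Max S"
    by (blast intro: Max_in, simp)
  have "of_nat k * (of_nat (Max S) * \<mu>) \<notin> Spec D" if "2 \<le> k" for k
  proof
    assume "of_nat k * (of_nat (Max S) * \<mu>) \<in> Spec D"
    then have "k * Max S \<in> S" using Max(1) that by (simp add: S_def mult.assoc)
    then have "k * Max S \<le> 1 * Max S" using Max(2) by force
    then show False using Max(1) that by (simp add: S_def)
  qed
  then show ?thesis using Max(1) by (auto simp: S_def)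
qed

theorem finite_orbits_imp_eigenvalue_root_of_unity:
  assumes germ: "time_one_map_germ W X F" and finite: "finite_orbits_property F"
    and \<mu>: "\<mu> \<in> Spec D"
  shows "\<exists>k>0. exp \<mu> ^ k = 1"
proof (rule ccontr)
  assume no_root: "\<not> (\<exists>k>0. exp \<mu> ^ k = 1)"
  then have "exp \<mu> \<noteq> 1" by (metis one_power2 zero_less_numeral)
  then have "\<mu> \<noteq> 0" by auto
  obtain m where m: "0 < m" "of_nat m * \<mu> \<in> Spec D"
    "\<And>k. 2 \<le> k \<Longrightarrow> of_nat k * (of_nat m * \<mu>) \<notin> Spec D"
    using nonresonant_multiple[OF \<mu> \<open>\<mu> \<noteq> 0\<close>] by blast
  define \<nu> where "\<nu> = of_nat m * \<mu>"
  have "\<nu> \<noteq> 0" using m(1) \<open>\<mu> \<noteq> 0\<close> by (simp add: \<nu>_def)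
  have not_root: "exp \<nu> ^ k \<noteq> 1" if "0 < k" for k
  proof -
    have "exp \<nu> ^ k = exp \<mu> ^ (m * k)"
      by (simp add: \<nu>_def exp_of_nat_mult power_mult)
    then show ?thesis using no_root m(1) that by (metis nat_0_less_mult_iff)
  qed
  obtain v where v: "v \<noteq> 0" "D v = \<nu> *s v" using m(2) by (auto simp: Spec_def \<nu>_def)
  have "\<forall>k\<ge>2. \<forall>w. D w = (of_nat k * \<nu>) *s w \<longrightarrow> w = 0"
    using m(3) unfolding Spec_def \<nu>_def by blast
  from separatrix_exists[OF \<open>\<nu> \<noteq> 0\<close> v(2) this]
  obtain r f where r: "0 < r" and f: "vec_holomorphic_on f (ball 0 r)" "f 0 = 0" "vec_deriv f 0 = v"
    and ode: "\<And>z. z \<in> ball 0 r \<Longrightarrow> (\<nu> * z) *s vec_deriv f z = X (f z)"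
    by blast
  obtain \<rho>1 where \<rho>1: "0 < \<rho>1" "\<And>z. z \<in> ball 0 \<rho>1 \<Longrightarrow> F (f z) = f (exp \<nu> * z)"
    using time_one_map_on_separatrix[OF germ r f(1,2) ode] by blast
  obtain \<rho>2 where \<rho>2: "0 < \<rho>2" "\<rho>2 \<le> r" "inj_on f (ball 0 \<rho>2)"
    using vec_holomorphic_locally_injective[OF f(1) r] f(3) v(1) by blast
  obtain U V G A where G: "diff_representative U V G F" and A: "A \<subseteq> U \<inter> V" "0 \<in> interior A"
    and fin: "finite_orbits_in U G A"
    using finite unfolding finite_orbits_property_def by blast
  have inj_G: "inj_on G U" using G by (auto simp: diff_representative_def biholomorphism_def bij_betw_def)
  obtain \<eta> where \<eta>: "0 < \<eta>" "\<And>x. norm x < \<eta> \<Longrightarrow> G x = F x"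
    using G unfolding diff_representative_def eventually_nhds_metric by auto
  have "isCont f 0" using vec_holomorphic_on_imp_continuous[OF f(1)] r by simp
  moreover have "f 0 \<in> interior A \<inter> ball 0 \<eta>" using A(2) f(2) \<eta>(1) by simp
  moreover have "0 < min \<rho>1 \<rho>2" using \<rho>1(1) \<rho>2(1) by simp
  ultimately obtain \<rho> where \<rho>: "0 < \<rho>" "\<rho> \<le> min \<rho>1 \<rho>2" "f ` ball 0 \<rho> \<subseteq> interior A \<inter> ball 0 \<eta>"
    using ball_mapped_into_open[of f "interior A \<inter> ball 0 \<eta>" "min \<rho>1 \<rho>2"] by blast
  have f_A: "f ` ball 0 \<rho> \<subseteq> A" using \<rho>(3) interior_subset[of A] by blast
  have G_f: "G (f z) = f (exp \<nu> * z)" if z: "z \<in> ball 0 \<rho>" for z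
  proof -
    have "f z \<in> ball 0 \<eta>" using \<rho>(3) z by blast
    then have "norm (f z) < \<eta>" by simp
    then have "G (f z) = F (f z)" by (rule \<eta>(2))
    also have "\<dots> = f (exp \<nu> * z)" using \<rho>(2) z by (intro \<rho>1(2)) auto
    finally show ?thesis .
  qed
  have inj: "inj_on f (ball 0 \<rho>)"
    using \<rho>2(3) \<rho>(2) by (elim inj_on_subset) auto
  define z where "z = complex_of_real (\<rho> / 2)"
  have z: "z \<in> ball 0 \<rho>" "z \<noteq> 0" using \<rho>(1) by (simp_all add: z_def)
  have "f z \<in> A" using f_A z(1) by blast
  then have "finite (orbit_in U G A (f z))" using fin by (simp add: finite_orbits_in_def)
  then have finite_pos: "finite (positive_orbit G A (f z))"
    and finite_neg: "finite (positive_orbit (inv_into U G) A (f z))"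
    by (simp_all add: orbit_in_def)
  show False
  proof (cases "norm (exp \<nu>) \<le> 1")
    case True
    then have "infinite (positive_orbit G A (f z))"
      using infinite_positive_orbit[OF inj f_A G_f True exp_not_eq_zero not_root z] by blast
    then show False using finite_pos by contradiction
  next
    case False
    then have le: "norm (exp (- \<nu>)) \<le> 1" by simp
    \<comment> \<open>Now exp(-\<nu>) shrinks the disc, so the candidate preimage still lies in
      \<open>A\<close>, hence in \<open>U\<close>, where \<open>G\<close> is injective.\<close>
    have inv_f: "inv_into U G (f z) = f (exp (- \<nu>) * z)" if z: "z \<in> ball 0 \<rho>" for z
    proof (rule inv_into_f_eq[OF inj_G])
      have "norm (exp (- \<nu>) * z) \<le> norm z" using le by (simp add: norm_mult mult_left_le_one_le)
      then have in_ball: "exp (- \<nu>) * z \<in> ball 0 \<rho>" using z by simp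
      then show "f (exp (- \<nu>) * z) \<in> U" using f_A A(1) by blast
      show "G (f (exp (- \<nu>) * z)) = f z"
        using G_f[OF in_ball] by (simp add: mult.assoc[symmetric] exp_add[symmetric])
    qed
    have inv_root: "exp (- \<nu>) ^ k \<noteq> 1" if "0 < k" for k
      using not_root[OF that] by (simp add: exp_minus power_inverse)
    have "infinite (positive_orbit (inv_into U G) A (f z))"
      using infinite_positive_orbit[OF inj f_A inv_f le exp_not_eq_zero inv_root z] by blast
    then show False using finite_neg by contradiction
  qed
qed

end

lemma root_of_unity_rational_argument:
  fixes \<mu> :: complex
  assumes "0 < k" "exp \<mu> ^ k = 1"
  shows "\<exists>q :: rat. exp \<mu> = exp (2 * of_real pi * \<i> * of_rat q)"
proof -
  have "exp (of_nat k * \<mu>) = 1" using assms(2) by (simp add: exp_of_nat_mult)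
  then obtain n :: int where "Re (of_nat k * \<mu>) = 0" "Im (of_nat k * \<mu>) = of_int (2 * n) * pi"
    by (auto simp: exp_eq_1)
  then have "of_nat k * \<mu> = 2 * of_real pi * \<i> * of_int n"
    by (simp add: complex_eq_iff)
  then have "\<mu> = 2 * of_real pi * \<i> * of_rat (of_int n / of_nat k)"
    using assms(1) by (simp add: of_rat_divide field_simps)
  then show ?thesis by blast
qed

theorem theorem2:
  fixes X F :: "complex ^ 'n \<Rightarrow> complex ^ 'n" and W :: "(complex ^ 'n) set"
  assumes "open W" and "0 \<in> W" and "holomorphic_map_on X W" and "X 0 = 0"
    and "time_one_map_germ W X F"
    and "finite_orbits_property F"
  shows "Spec (frechet_derivative F (at 0)) \<subseteq> {exp (2 * of_real pi * \<i> * of_rat q) | q :: rat. True}"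
proof
  obtain D where D: "Vector_Spaces.linear (*s) (*s) D" "(X has_derivative D) (at 0)"
    using assms(2,3) unfolding holomorphic_map_on_def by blast
  interpret singular_vector_field X D W
    by (intro singular_vector_field.intro assms(1-4) D)
  \<comment> \<open>The holomorphic representative contained in the finite orbits hypothesis
    supplies the differentiability of \<open>F\<close> at 0 and \<open>F 0 = 0\<close>.\<close>
  obtain U V G where G: "0 \<in> U" "holomorphic_map_on G U" "G 0 = 0" "\<forall>\<^sub>F z in nhds 0. G z = F z"
    using assms(6) unfolding finite_orbits_property_def diff_representative_def biholomorphism_def by blast
  obtain L where L: "Vector_Spaces.linear (*s) (*s) L" "(G has_derivative L) (at 0)"
    using G(1,2) unfolding holomorphic_map_on_def by blast
  have "F 0 = 0" using eventually_nhds_x_imp_x[OF G(4)] G(3) by simp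
  have deriv_F: "(F has_derivative L) (at 0)"
  proof (rule has_derivative_transform_eventually[OF L(2)])
    show "\<forall>\<^sub>F z in at 0. G z = F z"
      using G(4) unfolding eventually_at_filter by (rule eventually_mono) simp
  qed (use G(3) \<open>F 0 = 0\<close> in auto)
  fix \<xi> assume "\<xi> \<in> Spec (frechet_derivative F (at 0))"
  then have "\<xi> \<in> Spec L" using frechet_derivative_at[OF deriv_F] by simp
  then obtain \<mu> where "\<mu> \<in> Spec D" "exp \<mu> = \<xi>"
    using eigenvalue_of_time_one_map[OF assms(5) deriv_F \<open>F 0 = 0\<close> L(1)] by blast
  then show "\<xi> \<in> {exp (2 * of_real pi * \<i> * of_rat q) | q :: rat. True}"
    using finite_orbits_imp_eigenvalue_root_of_unity[OF assms(5,6)] root_of_unity_rational_argument by blast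
qed

end
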